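(* Let $n,r\in\mathbb{N}$ and write $n=a(r+1)+b$ with integers $a\ge 0$ and $0\le b\le r$. If $G$ is a graph on $n$ vertices with maximum degree $\Delta(G)\le r$, then \[ k(G)\le k(aK_{r+1}\cup K_b), \] with equality if and only if $G$ is isomorphic to $aK_{r+1}\cup K_b$, or $r=2$ and $G$ is isomorphic to $(a-1)K_3\cup C_4$ or to $(a-1)K_3\cup C_5$.
   Context: All graphs are finite and simple. A clique of $G$ is a set of vertices inducing a complete subgraph (not necessarily maximal); the empty set counts as a clique. $k(G)$ denotes the number of cliques of $G$ (including the empty one). $aK_{r+1}\cup K_b$ denotes the disjoint union of $a$ copies of the complete graph $K_{r+1}$ and one copy of $K_b$ (with $K_0$ the empty graph); $C_m$ is the cycle on $m$ vertices. *)

theory Defs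
  imports "Graph_Theory.Graph_Theory"
begin

text \<open>
  A finite simple graph is a \<^term>\<open>pair_graph\<close>: each undirected edge is represented by
  its two opposite arcs, so the degree of a vertex is its \<^term>\<open>out_degree\<close>.
\<close>

text \<open>The graph without vertices has maximum degree 0.\<close>

definition max_degree :: "'a pair_pre_digraph \<Rightarrow> nat" where
  "max_degree G = Max (insert 0 (out_degree (with_proj G) ` pverts G))"

definition clique :: "'a pair_pre_digraph \<Rightarrow> 'a set \<Rightarrow> bool" where
  "clique G S \<longleftrightarrow> S \<subseteq> pverts G \<and> complete_digraph (card S) (with_proj G \<restriction> S)"

definition num_cliques :: "'a pair_pre_digraph \<Rightarrow> nat" where
  "num_cliques G = card {S. clique G S}"

definition graph_iso :: "'a pair_pre_digraph \<Rightarrow> 'b pair_pre_digraph \<Rightarrow> bool" where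
  "graph_iso G H \<longleftrightarrow> digraph_iso (with_proj G) (with_proj H)"

definition complete_graph :: "nat \<Rightarrow> nat pair_pre_digraph" where
  "complete_graph m = \<lparr>pverts = {..<m}, parcs = {(u, v). u < m \<and> v < m \<and> u \<noteq> v}\<rparr>"

text \<open>The following is meaningful for \<open>m \<ge> 3\<close> only.\<close>

definition cycle_graph :: "nat \<Rightarrow> nat pair_pre_digraph" where
  "cycle_graph m = \<lparr>pverts = {..<m},
     parcs = {(u, v). u < m \<and> v < m \<and> (v = Suc u mod m \<or> u = Suc v mod m)}\<rparr>"

definition disjoint_copies :: "nat \<Rightarrow> 'a pair_pre_digraph \<Rightarrow> (nat \<times> 'a) pair_pre_digraph" where
  "disjoint_copies a G = \<lparr>pverts = {..<a} \<times> pverts G,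
     parcs = {((i, u), (i, v)) | i u v. i < a \<and> (u, v) \<in> parcs G}\<rparr>"

definition disjoint_union ::
    "'a pair_pre_digraph \<Rightarrow> 'b pair_pre_digraph \<Rightarrow> ('a + 'b) pair_pre_digraph" where
  "disjoint_union G H = \<lparr>pverts = pverts G <+> pverts H,
     parcs = map_prod Inl Inl ` parcs G \<union> map_prod Inr Inr ` parcs H\<rparr>"

end

theory Submission
  imports Defs
begin

text \<open>
  Call a vertex \<open>v\<close> light if at most \<open>2 ^ (d(v) + 1) - 1\<close> nonempty cliques meet its closed
  neighbourhood \<open>N[v]\<close>. Deleting \<open>N[v]\<close> for a light \<open>v\<close> and inducting gives the bound, by convexity
  of \<open>2 ^ x\<close>. Light vertices exist on average: after discarding the cliques inside \<open>N[v]\<close>, it suffices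
  to inject the pairs \<open>(v, K)\<close>, where the clique \<open>K\<close> meets \<open>N[v]\<close> without being contained in it, into the
  pairs \<open>(w, S)\<close>, where \<open>S \<subseteq> N[w]\<close> is not a clique. Take \<open>w\<close> to be a vertex of \<open>S = K \<union> {v}\<close>
  adjacent to all the others; \<open>v\<close> can be recovered from \<open>S\<close> unless \<open>S\<close> misses exactly one edge, and
  then the two candidates for \<open>v\<close> are separated by using \<open>S - {w}\<close> for one of them.

  If the bound is attained, every vertex is tight and the injection is onto. Hence every \<open>N[v]\<close> is either a
  clique, and then a component that can be split off, or \<open>v\<close> has exactly two neighbours and they are
  not adjacent. If no \<open>N[v]\<close> is a clique, the graph is 2-regular without triangles and has \<open>1 + 2 n\<close>
  cliques, which forces \<open>r = 2\<close> and \<open>n = 4\<close> or \<open>n = 5\<close>.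
\<close>

section \<open>Cliques and closed neighbourhoods in induced subgraphs\<close>

text \<open>The relation \<open>E\<close> stays fixed and only \<open>W\<close> shrinks when
  vertices are deleted, so induced subgraphs need no graph objects of their own.\<close>

definition cliques_in :: "'a rel \<Rightarrow> 'a set \<Rightarrow> 'a set set" where
  "cliques_in E W = {S. S \<subseteq> W \<and> (\<forall>x\<in>S. \<forall>y\<in>S. x \<noteq> y \<longrightarrow> (x, y) \<in> E)}"

definition closed_nbhd :: "'a rel \<Rightarrow> 'a set \<Rightarrow> 'a \<Rightarrow> 'a set" where
  "closed_nbhd E W v = {u \<in> W. u = v \<or> (v, u) \<in> E}"

definition cliques_meeting :: "'a rel \<Rightarrow> 'a set \<Rightarrow> 'a \<Rightarrow> 'a set set" where
  "cliques_meeting E W v = {K \<in> cliques_in E W. K \<inter> closed_nbhd E W v \<noteq> {}}"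

lemma cliques_in_subset_Pow: "cliques_in E W \<subseteq> Pow W"
  by (auto simp: cliques_in_def)

lemma finite_cliques_in: "finite W \<Longrightarrow> finite (cliques_in E W)"
  by (rule finite_subset[OF cliques_in_subset_Pow]) simp

lemma closed_nbhd_subset: "closed_nbhd E W v \<subseteq> W"
  by (auto simp: closed_nbhd_def)

lemma finite_closed_nbhd: "finite W \<Longrightarrow> finite (closed_nbhd E W v)"
  using closed_nbhd_subset finite_subset by metis

lemma empty_in_cliques_in: "{} \<in> cliques_in E W"
  by (simp add: cliques_in_def)

lemma cliques_inD: "S \<in> cliques_in E W \<Longrightarrow> x \<in> S \<Longrightarrow> y \<in> S \<Longrightarrow> x \<noteq> y \<Longrightarrow> (x, y) \<in> E"
  by (simp add: cliques_in_def)

text \<open>A clique avoiding the closed neighbourhood is a clique of what its deletion leaves;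
  every other clique meets it.\<close>

lemma card_cliques_in_delete_closed_nbhd:
  assumes "finite W"
  shows "card (cliques_in E W)
    = card (cliques_in E (W - closed_nbhd E W v)) + card (cliques_meeting E W v)"
proof -
  have "cliques_in E W = cliques_in E (W - closed_nbhd E W v) \<union> cliques_meeting E W v"
    by (auto simp: cliques_in_def cliques_meeting_def)
  moreover have "cliques_in E (W - closed_nbhd E W v) \<inter> cliques_meeting E W v = {}"
    by (auto simp: cliques_in_def cliques_meeting_def)
  moreover have "finite (cliques_in E (W - closed_nbhd E W v))" "finite (cliques_meeting E W v)"
    using assms by (simp_all add: finite_cliques_in cliques_meeting_def)
  ultimately show ?thesis
    by (metis card_Un_disjoint)
qed

section \<open>Double counting around closed neighbourhoods and the injection on crossing
  pairs\<close>

locale simple_rel =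
  fixes E :: "'a rel"
  assumes sym_E: "(x, y) \<in> E \<Longrightarrow> (y, x) \<in> E"
    and irrefl_E: "(x, x) \<notin> E"
begin

definition crossing_pairs :: "'a set \<Rightarrow> ('a \<times> 'a set) set" where
  "crossing_pairs W = {(v, K). v \<in> W \<and> K \<in> cliques_in E W \<and>
     K \<inter> closed_nbhd E W v \<noteq> {} \<and> \<not> K \<subseteq> closed_nbhd E W v}"

definition nonclique_pairs :: "'a set \<Rightarrow> ('a \<times> 'a set) set" where
  "nonclique_pairs W = {(w, S). w \<in> W \<and> S \<subseteq> closed_nbhd E W w \<and> S \<notin> cliques_in E W}"

lemma finite_crossing_pairs: "finite W \<Longrightarrow> finite (crossing_pairs W)"
  by (rule finite_subset[of _ "W \<times> cliques_in E W"])
     (auto simp: crossing_pairs_def finite_cliques_in)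

lemma finite_nonclique_pairs: "finite W \<Longrightarrow> finite (nonclique_pairs W)"
  by (rule finite_subset[of _ "W \<times> Pow W"])
     (auto simp: nonclique_pairs_def closed_nbhd_def)

text \<open>For each \<open>v\<close>, the nonempty cliques inside the closed neighbourhood occur
  both among the cliques meeting it and among its nonempty subsets. They cancel, leaving crossing
  cliques on one side and non-cliques on the other; the additive form avoids a difference of the two
  sums.\<close>

lemma sum_cliques_meeting_balance:
  assumes "finite W"
  shows "(\<Sum>v\<in>W. card (cliques_meeting E W v)) + card (nonclique_pairs W)
    = (\<Sum>v\<in>W. 2 ^ card (closed_nbhd E W v) - 1) + card (crossing_pairs W)"
proof -
  let ?P = "\<lambda>v. {K \<in> cliques_meeting E W v. \<not> K \<subseteq> closed_nbhd E W v}"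
  let ?Q = "\<lambda>v. {S. S \<subseteq> closed_nbhd E W v \<and> S \<notin> cliques_in E W}"
  let ?I = "\<lambda>v. {K \<in> cliques_in E W. K \<noteq> {} \<and> K \<subseteq> closed_nbhd E W v}"
  have fin: "finite (?P v)" "finite (?Q v)" "finite (?I v)" for v
    using assms finite_closed_nbhd[OF assms, of E v]
    by (simp_all add: finite_cliques_in cliques_meeting_def)
  have "card (cliques_meeting E W v) + card (?Q v)
      = (2 ^ card (closed_nbhd E W v) - 1) + card (?P v)" for v
  proof -
    have "cliques_meeting E W v = ?P v \<union> ?I v"
      by (auto simp: cliques_meeting_def)
    then have "card (cliques_meeting E W v) = card (?P v \<union> ?I v)" by (rule arg_cong)
    also have "\<dots> = card (?P v) + card (?I v)"
      by (rule card_Un_disjoint[OF fin(1) fin(3)]) blast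
    finally have c: "card (cliques_meeting E W v) = card (?P v) + card (?I v)" .
    have "Pow (closed_nbhd E W v) - {{}} = ?Q v \<union> ?I v"
      using empty_in_cliques_in[of E W] by auto
    then have "card (Pow (closed_nbhd E W v) - {{}}) = card (?Q v \<union> ?I v)" by (rule arg_cong)
    also have "\<dots> = card (?Q v) + card (?I v)"
      by (rule card_Un_disjoint[OF fin(2) fin(3)]) blast
    finally have "card (Pow (closed_nbhd E W v) - {{}}) = card (?Q v) + card (?I v)" .
    moreover have "card (Pow (closed_nbhd E W v) - {{}}) = 2 ^ card (closed_nbhd E W v) - 1"
      using finite_closed_nbhd[OF assms, of E v] by (simp add: card_Pow)
    ultimately show ?thesis using c by simp
  qed
  then have "(\<Sum>v\<in>W. card (cliques_meeting E W v)) + (\<Sum>v\<in>W. card (?Q v))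
      = (\<Sum>v\<in>W. 2 ^ card (closed_nbhd E W v) - 1) + (\<Sum>v\<in>W. card (?P v))"
    by (simp flip: sum.distrib)
  moreover have "crossing_pairs W = Sigma W ?P"
    by (auto simp: crossing_pairs_def cliques_meeting_def)
  moreover have "nonclique_pairs W = Sigma W ?Q"
    by (auto simp: nonclique_pairs_def)
  ultimately show ?thesis
    using assms fin by (simp add: card_SigmaI)
qed

text \<open>The choice depends on \<open>S\<close> alone. In the equality case this turns
  surjectivity of \<open>crossing_map\<close> into uniqueness of dominating vertices.\<close>

definition dominator :: "'a set \<Rightarrow> 'a set \<Rightarrow> 'a" where
  "dominator W S = (SOME w. w \<in> S \<and> S \<subseteq> closed_nbhd E W w)"

text \<open>A vertex of \<open>K\<close> in the neighbourhood of \<open>v\<close> is adjacent to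
  \<open>v\<close> and to the rest of the clique \<open>K\<close>, so a dominating vertex exists.
  The choice cannot be \<open>v\<close>, which is not adjacent to all of \<open>K\<close>.\<close>

lemma dominator_crossing_pair:
  assumes "(v, K) \<in> crossing_pairs W"
  defines "w \<equiv> dominator W (insert v K)"
  shows "w \<in> K" "(v, w) \<in> E" "insert v K \<subseteq> closed_nbhd E W w" "v \<notin> K" "w \<in> W"
proof -
  have v: "v \<in> W" and K: "K \<subseteq> W" "\<And>x y. x \<in> K \<Longrightarrow> y \<in> K \<Longrightarrow> x \<noteq> y \<Longrightarrow> (x, y) \<in> E"
    using assms by (auto simp: crossing_pairs_def cliques_in_def)
  obtain b where b: "b \<in> K" "b \<noteq> v" "(v, b) \<notin> E"
    using assms K by (auto simp: crossing_pairs_def closed_nbhd_def)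
  show vK: "v \<notin> K" using b K by blast
  obtain u where "u \<in> K" "(v, u) \<in> E"
    using assms vK by (auto simp: crossing_pairs_def closed_nbhd_def)
  then have "u \<in> insert v K \<and> insert v K \<subseteq> closed_nbhd E W u"
    using v K sym_E by (auto simp: closed_nbhd_def)
  then have w: "w \<in> insert v K \<and> insert v K \<subseteq> closed_nbhd E W w"
    unfolding w_def dominator_def by (rule someI)
  then show "insert v K \<subseteq> closed_nbhd E W w" by simp
  have "w \<noteq> v" using w b by (auto simp: closed_nbhd_def)
  then show "w \<in> K" "(v, w) \<in> E"
    using w sym_E by (auto simp: closed_nbhd_def)
  then show "w \<in> W" using K by auto
qed

text \<open>If \<open>b\<close> is the only vertex of \<open>K\<close> outside the neighbourhood of
  \<open>v\<close>, exchanging \<open>v\<close> and \<open>b\<close> can give a second pair with the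
  same union \<open>S\<close>. The labels \<open>g\<close> break this symmetry: the pair whose first
  vertex has the larger label loses \<open>w\<close> from its set.\<close>

definition crossing_map :: "('a \<Rightarrow> nat) \<Rightarrow> 'a set \<Rightarrow> 'a \<times> 'a set \<Rightarrow> 'a \<times> 'a set" where
  "crossing_map g W = (\<lambda>(v, K). let S = insert v K; w = dominator W S in
     if \<exists>b. K - closed_nbhd E W v = {b} \<and> g b < g v then (w, S - {w}) else (w, S))"

lemma fst_crossing_map: "fst (crossing_map g W (v, K)) = dominator W (insert v K)"
  unfolding crossing_map_def prod.case Let_def by (simp split: if_split)

lemma crossing_map_in_nonclique_pairs:
  assumes "p \<in> crossing_pairs W"
  shows "crossing_map g W p \<in> nonclique_pairs W"
proof -
  obtain v K where p: "p = (v, K)" by fastforce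
  define w where "w = dominator W (insert v K)"
  note d = dominator_crossing_pair[OF assms[unfolded p], folded w_def]
  obtain b where b: "b \<in> K" "b \<noteq> v" "(v, b) \<notin> E"
    using assms p by (auto simp: crossing_pairs_def closed_nbhd_def cliques_in_def)
  \<comment> \<open>The non-edge between \<open>v\<close> and \<open>b\<close> survives the removal
    of \<open>w\<close>, since \<open>w\<close> is neither of the two.\<close>
  have "w \<noteq> b" "w \<noteq> v" using b d by auto
  moreover have "S \<notin> cliques_in E W" if "v \<in> S" "b \<in> S" for S
    using that b cliques_inD by metis
  ultimately have "insert v K - {w} \<notin> cliques_in E W" "insert v K \<notin> cliques_in E W"
    using b by auto
  then show ?thesis
    using d p by (auto simp: crossing_map_def Let_def nonclique_pairs_def simp flip: w_def)
qed

lemma inj_on_crossing_map: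
  assumes g: "inj_on g W"
  shows "inj_on (crossing_map g W) (crossing_pairs W)"
proof (rule inj_onI, clarify)
  fix v K v' K'
  assume p: "(v, K) \<in> crossing_pairs W" and p': "(v', K') \<in> crossing_pairs W"
    and eq: "crossing_map g W (v, K) = crossing_map g W (v', K')"
  define w where "w = dominator W (insert v K)"
  define w' where "w' = dominator W (insert v' K')"
  note d = dominator_crossing_pair[OF p, folded w_def]
  note d' = dominator_crossing_pair[OF p', folded w'_def]
  define sing where "sing \<longleftrightarrow> (\<exists>b. K - closed_nbhd E W v = {b} \<and> g b < g v)"
  define sing' where "sing' \<longleftrightarrow> (\<exists>b. K' - closed_nbhd E W v' = {b} \<and> g b < g v')"
  have m: "crossing_map g W (v, K) = (w, if sing then insert v K - {w} else insert v K)"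
    unfolding crossing_map_def prod.case Let_def w_def[symmetric] sing_def[symmetric] by simp
  have m': "crossing_map g W (v', K') = (w', if sing' then insert v' K' - {w'} else insert v' K')"
    unfolding crossing_map_def prod.case Let_def w'_def[symmetric] sing'_def[symmetric] by simp
  have ww: "w = w'" using eq m m' by simp
  \<comment> \<open>As \<open>w\<close> always lies in \<open>insert v K\<close>, its absence from
    the image reveals which branch was taken.\<close>
  have "sing \<longleftrightarrow> w \<notin> snd (crossing_map g W (v, K))"
    "sing' \<longleftrightarrow> w \<notin> snd (crossing_map g W (v', K'))"
    unfolding m m' using d(1) d'(1) ww by simp_all
  then have same: "sing = sing'" using eq by simp
  have S: "insert v K = insert v' K'"
  proof (cases sing)
    case True
    then have "insert v K - {w} = insert v' K' - {w}" using eq m m' same ww by simp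
    then show ?thesis using d(1) d'(1) ww by blast
  next
    case False
    then show ?thesis using eq m m' same by simp
  qed
  have "v = v'"
  proof (rule ccontr)
    assume ne: "v \<noteq> v'"
    then have in_K: "v \<in> K'" "v' \<in> K" using S by auto
    \<comment> \<open>Every other vertex of \<open>K\<close> lies together with \<open>v\<close> in
      the clique \<open>K'\<close>, so \<open>v'\<close> is the only vertex of the union not
      adjacent to \<open>v\<close>.\<close>
    have "K - closed_nbhd E W v \<subseteq> {v'}"
    proof
      fix x assume x: "x \<in> K - closed_nbhd E W v"
      show "x \<in> {v'}"
      proof (rule ccontr)
        assume "x \<notin> {v'}"
        then have "x \<in> K'" using x S by blast
        then have "x = v \<or> (v, x) \<in> E" "x \<in> W"
          using in_K p' by (auto simp: crossing_pairs_def cliques_in_def)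
        then show False using x by (auto simp: closed_nbhd_def)
      qed
    qed
    then have B: "K - closed_nbhd E W v = {v'}"
      using p by (auto simp: crossing_pairs_def)
    have "K' - closed_nbhd E W v' \<subseteq> {v}"
    proof
      fix x assume x: "x \<in> K' - closed_nbhd E W v'"
      show "x \<in> {v}"
      proof (rule ccontr)
        assume "x \<notin> {v}"
        then have "x \<in> K" using x S by blast
        then have "x = v' \<or> (v', x) \<in> E" "x \<in> W"
          using in_K p by (auto simp: crossing_pairs_def cliques_in_def)
        then show False using x by (auto simp: closed_nbhd_def)
      qed
    qed
    then have B': "K' - closed_nbhd E W v' = {v}"
      using p' by (auto simp: crossing_pairs_def)
    \<comment> \<open>Both pairs took the same branch although their tests compare the same two
      labels in opposite directions; hence neither inequality holds.\<close>
    have "g v' < g v \<longleftrightarrow> g v < g v'"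
      using same unfolding sing_def sing'_def B B' by auto
    then have "g v = g v'" by linarith
    moreover have "v \<in> W" "v' \<in> W" using p p' by (auto simp: crossing_pairs_def)
    ultimately show False using ne g by (auto dest: inj_onD)
  qed
  moreover have "v \<notin> K" "v' \<notin> K'" using d(4) d'(4) by auto
  ultimately show "v = v' \<and> K = K'" using S by (metis insert_ident)
qed

lemma card_crossing_pairs_le:
  assumes "finite W"
  shows "card (crossing_pairs W) \<le> card (nonclique_pairs W)"
proof -
  obtain g :: "'a \<Rightarrow> nat" where "inj_on g W"
    using finite_imp_inj_to_nat_seg[OF assms] by auto
  then show ?thesis
    using card_inj_on_le[OF inj_on_crossing_map _ finite_nonclique_pairs[OF assms]]
      crossing_map_in_nonclique_pairs by blast
qed

lemma sum_cliques_meeting_le: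
  assumes "finite W"
  shows "(\<Sum>v\<in>W. card (cliques_meeting E W v)) \<le> (\<Sum>v\<in>W. 2 ^ card (closed_nbhd E W v) - 1)"
  using sum_cliques_meeting_balance[OF assms] card_crossing_pairs_le[OF assms] by simp

text \<open>Since \<open>crossing_map\<close> is onto, a non-clique has at most one dominating vertex, so two
  non-adjacent neighbours of \<open>w\<close> leave no room for a third neighbour.\<close>

lemma closed_nbhd_if_balanced:
  assumes "finite W"
    and eq: "(\<Sum>v\<in>W. card (cliques_meeting E W v)) = (\<Sum>v\<in>W. 2 ^ card (closed_nbhd E W v) - 1)"
    and w: "w \<in> W" "closed_nbhd E W w \<notin> cliques_in E W"
  obtains x y where "closed_nbhd E W w = {w, x, y}" "x \<noteq> y" "x \<noteq> w" "y \<noteq> w" "(x, y) \<notin> E"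
proof -
  obtain g :: "'a \<Rightarrow> nat" where g: "inj_on g W"
    using finite_imp_inj_to_nat_seg[OF assms(1)] by auto
  have "card (crossing_map g W ` crossing_pairs W) = card (nonclique_pairs W)"
    using sum_cliques_meeting_balance[OF assms(1)] eq card_image[OF inj_on_crossing_map[OF g]]
    by simp
  then have onto: "crossing_map g W ` crossing_pairs W = nonclique_pairs W"
    by (intro card_subset_eq finite_nonclique_pairs assms(1) image_subsetI
        crossing_map_in_nonclique_pairs)
  have pre: "\<exists>v K. (v, K) \<in> crossing_pairs W \<and> u = dominator W (insert v K) \<and>
      (u \<in> S \<and> S = insert v K \<or>
       u \<notin> S \<and> S = insert v K - {u} \<and> (\<exists>b. K - closed_nbhd E W v = {b}))"
    if uS: "(u, S) \<in> nonclique_pairs W" for u S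
  proof -
    obtain p where "p \<in> crossing_pairs W" "(u, S) = crossing_map g W p"
      using uS unfolding onto[symmetric] by blast
    then obtain v K where vK: "(v, K) \<in> crossing_pairs W" "(u, S) = crossing_map g W (v, K)"
      by (cases p) simp
    note d = dominator_crossing_pair[OF vK(1)]
    show ?thesis
    proof (intro exI conjI)
      show "(v, K) \<in> crossing_pairs W" by (fact vK(1))
      show u: "u = dominator W (insert v K)"
        using vK(2) fst_crossing_map by (metis fst_conv)
      show "u \<in> S \<and> S = insert v K \<or>
          u \<notin> S \<and> S = insert v K - {u} \<and> (\<exists>b. K - closed_nbhd E W v = {b})"
      proof (cases "\<exists>b. K - closed_nbhd E W v = {b} \<and> g b < g v")
        case True
        then have "S = insert v K - {u}"
          using vK(2) u unfolding crossing_map_def prod.case Let_def if_P[OF True] by simp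
        then show ?thesis using True by blast
      next
        case False
        then have "S = insert v K"
          using vK(2) unfolding crossing_map_def prod.case Let_def if_not_P[OF False] by simp
        then show ?thesis using d(1) u by simp
      qed
    qed
  qed
  \<comment> \<open>A set that contains its first component comes from the branch that keeps
    \<open>w\<close>, so it equals the union from which the dominator was chosen.\<close>
  have uniq: "u = dominator W S" if "(u, S) \<in> nonclique_pairs W" "u \<in> S" for u S
    using pre[OF that(1)] that(2) by auto
  obtain x y where xy: "x \<in> closed_nbhd E W w" "y \<in> closed_nbhd E W w" "x \<noteq> y" "(x, y) \<notin> E"
    using w closed_nbhd_subset[of E W w] by (auto simp: cliques_in_def)
  then have ne: "x \<noteq> w" "y \<noteq> w" using sym_E by (auto simp: closed_nbhd_def)
  have False if z: "z \<in> closed_nbhd E W w" "z \<noteq> w" "z \<noteq> x" "z \<noteq> y" for z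
  proof -
    \<comment> \<open>The set omits \<open>w\<close>, so its preimage must come from the branch that
      deletes \<open>w\<close>; this branch supplies the single exceptional vertex
      \<open>b\<close>.\<close>
    have "(w, {x, y, z}) \<in> nonclique_pairs W"
      using xy z w by (auto simp: nonclique_pairs_def cliques_in_def)
    from pre[OF this] obtain v K b where vK: "(v, K) \<in> crossing_pairs W"
      and dom: "w = dominator W (insert v K)"
      and S: "{x, y, z} = insert v K - {w}" and b: "K - closed_nbhd E W v = {b}"
      using ne z by auto
    note d = dominator_crossing_pair[OF vK, folded dom]
    have K: "K \<subseteq> W" "\<And>x y. x \<in> K \<Longrightarrow> y \<in> K \<Longrightarrow> x \<noteq> y \<Longrightarrow> (x, y) \<in> E" "v \<in> W"
      using vK by (auto simp: crossing_pairs_def cliques_in_def)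
    \<comment> \<open>Three distinct vertices cannot all be \<open>v\<close> or \<open>b\<close>.
      The one left over lies in \<open>K\<close> and is adjacent to \<open>v\<close>, so it
      dominates \<open>insert v K\<close> as \<open>w\<close> does, against uniqueness.\<close>
    have "\<exists>z'\<in>{x, y, z}. z' \<noteq> v \<and> z' \<noteq> b"
      using xy(3) z by auto
    then obtain z' where z': "z' \<in> K" "z' \<noteq> w" "z' \<noteq> v" "z' \<noteq> b" using S by blast
    then have "(v, z') \<in> E" using b by (auto simp: closed_nbhd_def)
    then have "insert v K \<subseteq> closed_nbhd E W z'"
      using z' K sym_E by (auto simp: closed_nbhd_def)
    moreover have "insert v K \<notin> cliques_in E W"
    proof
      assume c: "insert v K \<in> cliques_in E W"
      have bK: "b \<in> K" "b \<notin> closed_nbhd E W v" using b by auto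
      then have "b = v \<or> (v, b) \<in> E" using cliques_inD[OF c, of v b] by auto
      then show False using bK K(1) by (auto simp: closed_nbhd_def)
    qed
    ultimately have "(z', insert v K) \<in> nonclique_pairs W"
      using z' K by (auto simp: nonclique_pairs_def)
    then have "z' = dominator W (insert v K)" using uniq z' by auto
    then show False using z' dom by simp
  qed
  then have "closed_nbhd E W w = {w, x, y}"
    using xy w by (auto simp: closed_nbhd_def)
  then show ?thesis using that xy ne by blast
qed

end

section \<open>The extremal clique count\<close>

text \<open>This is the clique count of the extremal graph on \<open>n\<close> vertices: every full
  copy contributes its nonempty cliques, and the last power includes the empty clique.\<close>

definition extremal_count :: "nat \<Rightarrow> nat \<Rightarrow> nat" where
  "extremal_count r n = n div (r + 1) * (2 ^ (r + 1) - 1) + 2 ^ (n mod (r + 1))"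

lemma extremal_count_eq:
  "b \<le> r \<Longrightarrow> extremal_count r (a * (r + 1) + b) = a * (2 ^ (r + 1) - 1) + 2 ^ b"
  unfolding extremal_count_def by (subst div_mult_self3, simp, subst mod_mult_self3) simp

text \<open>This is \<open>(2 ^ p - 1) * (2 ^ q - 1) \<ge> 0\<close> expanded; writing the powers as
  successors avoids the subtraction.\<close>

lemma two_power_add_le: "(2::nat) ^ p + 2 ^ q \<le> 2 ^ (p + q) + 1"
proof -
  obtain s t where "(2::nat) ^ p = Suc s" "(2::nat) ^ q = Suc t"
    by (metis not0_implies_Suc power_not_zero zero_neq_numeral)
  then show ?thesis by (simp add: power_add)
qed

lemma two_power_add_less:
  assumes "0 < p" "0 < q"
  shows "(2::nat) ^ p + 2 ^ q < 2 ^ (p + q) + 1"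
proof -
  obtain s t where "p = Suc s" "q = Suc t"
    using assms by (metis gr0_implies_Suc)
  then have "(2::nat) ^ p = 2 * 2 ^ s" "(2::nat) ^ q = 2 * 2 ^ t"
    "(2::nat) ^ (p + q) = 4 * (2 ^ s * 2 ^ t)" by (simp_all add: power_add)
  moreover have "1 \<le> (2::nat) ^ s * 2 ^ t" by simp
  moreover have "2 ^ s + 2 ^ t \<le> (2::nat) ^ s * 2 ^ t + 1"
    using two_power_add_le by (metis power_add)
  ultimately show ?thesis by linarith
qed

text \<open>Convexity of powers of two: adding a clique of \<open>x\<close> vertices as its own
  component is no better than merging it into the remainder, or than completing a full copy and
  keeping the overflow. Equality needs an empty remainder before the addition, or a full copy as the
  added clique.\<close>

lemma extremal_count_delete:
  assumes x: "1 \<le> x" "x \<le> r + 1" "x \<le> n"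
  shows "extremal_count r (n - x) + (2 ^ x - 1) \<le> extremal_count r n"
    and "extremal_count r (n - x) + (2 ^ x - 1) = extremal_count r n \<Longrightarrow>
      x = r + 1 \<or> x = n mod (r + 1)"
proof -
  \<comment> \<open>Quotient and remainder are those of \<open>n - x\<close>, so that adding
    \<open>x\<close> back causes at most one carry.\<close>
  define a where "a = (n - x) div (r + 1)"
  define b where "b = (n - x) mod (r + 1)"
  have b: "b \<le> r" unfolding b_def using mod_less_divisor[of "r + 1" "n - x"] by linarith
  have nx: "n - x = a * (r + 1) + b" unfolding a_def b_def by (rule div_mult_mod_eq[symmetric])
  have m: "extremal_count r (n - x) = a * (2 ^ (r + 1) - 1) + 2 ^ b"
    unfolding nx using b by (rule extremal_count_eq)
  have one: "1 \<le> (2::nat) ^ k" for k by simp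
  have "extremal_count r (n - x) + (2 ^ x - 1) \<le> extremal_count r n \<and>
    (extremal_count r (n - x) + (2 ^ x - 1) = extremal_count r n \<longrightarrow>
      x = r + 1 \<or> x = n mod (r + 1))"
  proof (cases "b + x \<le> r")
    case True
    have n: "n = a * (r + 1) + (b + x)" using nx x by linarith
    have e: "extremal_count r n = a * (2 ^ (r + 1) - 1) + 2 ^ (b + x)"
      unfolding n using True by (rule extremal_count_eq)
    show ?thesis
    proof (cases "b = 0")
      case True
      then have "x = n mod (r + 1)"
        unfolding n using \<open>b + x \<le> r\<close> by (subst mod_mult_self3) simp
      then show ?thesis
        unfolding m e using one[of x] two_power_add_le[of b x] by linarith
    next
      case False
      then have "2 ^ b + 2 ^ x < 2 ^ (b + x) + (1::nat)"
        using x by (intro two_power_add_less) auto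
      then show ?thesis
        unfolding m e using one[of x] by linarith
    qed
  next
    case False
    \<comment> \<open>The carry case: \<open>y\<close> is the new remainder. Dividing by
      \<open>2 ^ y\<close> leaves the exponents \<open>p\<close> and \<open>q\<close>, where
      \<open>q = r + 1 - x\<close> vanishes exactly if the added clique is a full copy.\<close>
    define y where "y = b + x - (r + 1)"
    have y: "y \<le> r" "b + x = r + 1 + y" using False b x unfolding y_def by auto
    have n: "n = (a + 1) * (r + 1) + y" using nx x y by (simp add: algebra_simps)
    have e: "extremal_count r n = (a + 1) * (2 ^ (r + 1) - 1) + 2 ^ y"
      unfolding n using y(1) by (rule extremal_count_eq)
    define p where "p = x - y"
    define q where "q = b - y"
    have pq: "x = y + p" "b = y + q" "r + 1 = y + (p + q)" "0 < p"
      using y x b unfolding p_def q_def by auto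
    have le: "(2::nat) ^ x + 2 ^ b \<le> 2 ^ (r + 1) + 2 ^ y"
    proof -
      have "(2::nat) ^ x + 2 ^ b = 2 ^ y * (2 ^ p + 2 ^ q)"
        unfolding pq(1,2) by (simp add: power_add algebra_simps)
      also have "\<dots> \<le> 2 ^ y * (2 ^ (p + q) + 1)"
        by (intro mult_left_mono two_power_add_le) simp
      also have "\<dots> = 2 ^ (r + 1) + 2 ^ y"
        unfolding pq(3) by (simp add: power_add algebra_simps)
      finally show ?thesis .
    qed
    have less: "(2::nat) ^ x + 2 ^ b < 2 ^ (r + 1) + 2 ^ y" if "x \<noteq> r + 1"
    proof -
      have "0 < q" using that pq by auto
      have "(2::nat) ^ x + 2 ^ b = 2 ^ y * (2 ^ p + 2 ^ q)"
        unfolding pq(1,2) by (simp add: power_add algebra_simps)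
      also have "\<dots> < 2 ^ y * (2 ^ (p + q) + 1)"
        using \<open>0 < p\<close> \<open>0 < q\<close> by (intro mult_strict_left_mono two_power_add_less) simp_all
      also have "\<dots> = 2 ^ (r + 1) + 2 ^ y"
        unfolding pq(3) by (simp add: power_add algebra_simps)
      finally show ?thesis .
    qed
    have "(a + 1) * (2 ^ (r + 1) - 1) = a * (2 ^ (r + 1) - 1) + (2 ^ (r + 1) - (1::nat))"
      by simp
    then show ?thesis
      unfolding m e using one[of x] one[of "r + 1"] le less by linarith
  qed
  then show "extremal_count r (n - x) + (2 ^ x - 1) \<le> extremal_count r n"
    and "extremal_count r (n - x) + (2 ^ x - 1) = extremal_count r n \<Longrightarrow>
      x = r + 1 \<or> x = n mod (r + 1)" by auto
qed

lemma twice_le_two_power: "2 * b \<le> (2::nat) ^ b"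
proof (induction b)
  case (Suc b)
  then show ?case by (cases b) auto
qed simp

text \<open>If \<open>r \<ge> 3\<close>, each full copy exceeds twice its vertex number by at least
  7, while the remainder can fall short of \<open>1 + 2 * b\<close> by at most 1. If
  \<open>r = 2\<close>, the equation becomes \<open>a + 2 ^ b = 1 + 2 * b\<close>, which for
  positive \<open>a\<close> leaves \<open>a = 1\<close> with \<open>b = 1\<close> or
  \<open>b = 2\<close>.\<close>

lemma extremal_count_eq_twice_plus_one:
  assumes eq: "extremal_count r n = 1 + 2 * n" and "0 < n" "2 \<le> r"
  shows "r = 2" "n = 4 \<or> n = 5"
proof -
  define a where "a = n div (r + 1)"
  define b where "b = n mod (r + 1)"
  have n: "n = a * (r + 1) + b" unfolding a_def b_def by (rule div_mult_mod_eq[symmetric])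
  have bal: "a * (2 ^ (r + 1) - 1) + 2 ^ b = 1 + 2 * (a * (r + 1)) + 2 * b"
    using eq n unfolding extremal_count_def a_def b_def by simp
  have "a \<noteq> 0"
  proof
    assume "a = 0"
    then have e: "2 ^ b = 1 + 2 * b" using bal by simp
    then have "odd ((2::nat) ^ b)" by simp
    then have "b = 0" by simp
    then show False using n \<open>a = 0\<close> assms by simp
  qed
  \<comment> \<open>With \<open>r = k + 3\<close> this reads
    \<open>2 * (r + 1) + 8 \<le> 2 ^ (r + 1)\<close>, sharp at \<open>k = 0\<close>.\<close>
  have pow: "2 * (k + 4) + 8 \<le> 16 * (2::nat) ^ k" for k by (induction k) auto
  show r: "r = 2"
  proof (rule ccontr)
    assume "r \<noteq> 2"
    then obtain k where k: "r = k + 3" using assms(3) by (intro that[of "r - 3"]) simp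
    have "(2::nat) ^ (r + 1) = 16 * 2 ^ k" unfolding k by (simp add: power_add)
    moreover have "2 * (r + 1) + 8 \<le> 16 * (2::nat) ^ k" using pow[of k] k by simp
    ultimately have "2 * (r + 1) + 7 \<le> (2::nat) ^ (r + 1) - 1" by linarith
    then have "a * (2 * (r + 1) + 7) \<le> a * (2 ^ (r + 1) - 1)" by (rule mult_left_mono) simp
    then have "2 * (a * (r + 1)) + 7 * a \<le> a * (2 ^ (r + 1) - 1)" by (simp add: algebra_simps)
    then show False using bal twice_le_two_power[of b] \<open>a \<noteq> 0\<close> by linarith
  qed
  have b: "b \<le> 2" using r unfolding b_def by auto
  then have "b = 0 \<or> b = 1 \<or> b = 2" by linarith
  then show "n = 4 \<or> n = 5"
    using bal n r \<open>a \<noteq> 0\<close> by auto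
qed

section \<open>The upper bound by induction, and the consequences of equality\<close>

context simple_rel
begin

lemma card_closed_nbhd_Diff_le:
  assumes "finite W" "card (closed_nbhd E W v) \<le> k"
  shows "card (closed_nbhd E (W - N) v) \<le> k"
proof -
  have "card (closed_nbhd E (W - N) v) \<le> card (closed_nbhd E W v)"
    by (intro card_mono finite_closed_nbhd assms) (auto simp: closed_nbhd_def)
  then show ?thesis using assms by simp
qed

lemma card_cliques_in_le:
  assumes "finite W" and "\<And>v. v \<in> W \<Longrightarrow> card (closed_nbhd E W v) \<le> r + 1"
  shows "card (cliques_in E W) \<le> extremal_count r (card W)"
  using assms
proof (induction "card W" arbitrary: W rule: less_induct)
  case less
  show ?case
  proof (cases "W = {}")
    case True
    then have "cliques_in E W = {{}}" by (auto simp: cliques_in_def)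
    then show ?thesis using True by (simp add: extremal_count_def)
  next
    case False
    \<comment> \<open>A light vertex exists because the averaged inequality would fail if every
      summand exceeded its bound.\<close>
    have "\<exists>v\<in>W. card (cliques_meeting E W v) \<le> 2 ^ card (closed_nbhd E W v) - 1"
    proof (rule ccontr)
      assume "\<not> ?thesis"
      then have "(\<Sum>v\<in>W. 2 ^ card (closed_nbhd E W v) - 1)
          < (\<Sum>v\<in>W. card (cliques_meeting E W v))"
        using False less.prems(1) by (intro sum_strict_mono) auto
      then show False using sum_cliques_meeting_le[OF less.prems(1)] by linarith
    qed
    then obtain v where v: "v \<in> W"
      "card (cliques_meeting E W v) \<le> 2 ^ card (closed_nbhd E W v) - 1" by blast
    let ?N = "closed_nbhd E W v"
    have "v \<in> ?N" using v by (simp add: closed_nbhd_def)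
    then have N: "1 \<le> card ?N" "card ?N \<le> r + 1" "card ?N \<le> card W"
      using finite_closed_nbhd[OF less.prems(1)] less.prems v closed_nbhd_subset[of E W v]
      by (auto simp: Suc_le_eq card_gt_0_iff intro: card_mono)
    have cW: "card (W - ?N) = card W - card ?N"
      by (rule card_Diff_subset[OF finite_closed_nbhd[OF less.prems(1)] closed_nbhd_subset])
    have "card (cliques_in E (W - ?N)) \<le> extremal_count r (card (W - ?N))"
    proof (rule less.hyps)
      show "card (W - ?N) < card W" using cW N by linarith
      show "finite (W - ?N)" using less.prems by simp
      show "card (closed_nbhd E (W - ?N) u) \<le> r + 1" if "u \<in> W - ?N" for u
        using that less.prems by (intro card_closed_nbhd_Diff_le) auto
    qed
    then show ?thesis
      using card_cliques_in_delete_closed_nbhd[OF less.prems(1), of E v] v(2)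
        extremal_count_delete(1)[OF N] unfolding cW by linarith
  qed
qed

text \<open>What remains after deleting the closed neighbourhood of any \<open>u\<close> obeys the
  upper bound, so at least \<open>2 ^ card (closed_nbhd E W u) - 1\<close> cliques meet that
  neighbourhood. The averaged inequality in the other direction forces equality at every vertex.
  Then the rest is extremal too, and only the equality cases of \<open>extremal_count_delete\<close>
  survive.\<close>

lemma extremal_tight:
  assumes "finite W" and deg: "\<And>v. v \<in> W \<Longrightarrow> card (closed_nbhd E W v) \<le> r + 1"
    and ext: "card (cliques_in E W) = extremal_count r (card W)" and v: "v \<in> W"
  defines "N \<equiv> closed_nbhd E W v"
  shows "(\<Sum>v\<in>W. card (cliques_meeting E W v)) = (\<Sum>v\<in>W. 2 ^ card (closed_nbhd E W v) - 1)"
    and "card (cliques_meeting E W v) = 2 ^ card N - 1"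
    and "card (cliques_in E (W - N)) = extremal_count r (card (W - N))"
    and "card N = r + 1 \<or> card N = card W mod (r + 1)"
    and "card (W - N) = card W - card N"
proof -
  have step: "1 \<le> card (closed_nbhd E W u)" "card (closed_nbhd E W u) \<le> r + 1"
    "card (closed_nbhd E W u) \<le> card W"
    "card (W - closed_nbhd E W u) = card W - card (closed_nbhd E W u)"
    "card (cliques_in E (W - closed_nbhd E W u))
       \<le> extremal_count r (card W - card (closed_nbhd E W u))"
    if "u \<in> W" for u
  proof -
    have "u \<in> closed_nbhd E W u" using that by (simp add: closed_nbhd_def)
    then show "1 \<le> card (closed_nbhd E W u)" "card (closed_nbhd E W u) \<le> r + 1"
      "card (closed_nbhd E W u) \<le> card W"
      using finite_closed_nbhd[OF assms(1)] assms(1) deg that closed_nbhd_subset[of E W u]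
      by (auto simp: Suc_le_eq card_gt_0_iff intro: card_mono)
    show c: "card (W - closed_nbhd E W u) = card W - card (closed_nbhd E W u)"
      by (rule card_Diff_subset[OF finite_closed_nbhd[OF assms(1)] closed_nbhd_subset])
    show "card (cliques_in E (W - closed_nbhd E W u))
       \<le> extremal_count r (card W - card (closed_nbhd E W u))"
      unfolding c[symmetric]
      by (rule card_cliques_in_le) (auto simp: assms(1) intro!: card_closed_nbhd_Diff_le dest: deg)
  qed
  have ge: "2 ^ card (closed_nbhd E W u) - 1 \<le> card (cliques_meeting E W u)" if "u \<in> W" for u
    using step[OF that] extremal_count_delete(1)[OF step(1-3)[OF that]] ext
      card_cliques_in_delete_closed_nbhd[OF assms(1), of E u] by linarith
  show eq: "(\<Sum>v\<in>W. card (cliques_meeting E W v)) = (\<Sum>v\<in>W. 2 ^ card (closed_nbhd E W v) - 1)"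
    using sum_cliques_meeting_le[OF assms(1)] sum_mono[of W "\<lambda>v. 2 ^ card (closed_nbhd E W v) - 1"
        "\<lambda>v. card (cliques_meeting E W v)", OF ge] by simp
  show c: "card (cliques_meeting E W v) = 2 ^ card N - 1"
    unfolding N_def using sum_mono_inv[OF eq[symmetric] ge v assms(1)] by simp
  have t: "card (cliques_in E (W - N)) \<le> extremal_count r (card W - card N)"
    "extremal_count r (card W - card N) + (2 ^ card N - 1) \<le> extremal_count r (card W)"
    using step[OF v] extremal_count_delete(1)[OF step(1-3)[OF v]] unfolding N_def by auto
  have d: "card (cliques_in E W) = card (cliques_in E (W - N)) + (2 ^ card N - 1)"
    using card_cliques_in_delete_closed_nbhd[OF assms(1), of E v] c unfolding N_def by simp
  show cN: "card (W - N) = card W - card N" using step(4)[OF v] unfolding N_def .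
  show "card (cliques_in E (W - N)) = extremal_count r (card (W - N))"
    using t d ext unfolding cN by linarith
  have "extremal_count r (card W - card N) + (2 ^ card N - 1) = extremal_count r (card W)"
    using t d ext by linarith
  then show "card N = r + 1 \<or> card N = card W mod (r + 1)"
    using extremal_count_delete(2)[OF step(1-3)[OF v]] unfolding N_def by blast
qed

text \<open>The nonempty subsets of the neighbourhood already account for all cliques meeting it; an
  edge leaving it would be one more.\<close>

lemma clique_closed_nbhd_isolated:
  assumes "finite W" "v \<in> W" and N: "closed_nbhd E W v \<in> cliques_in E W"
    and c: "card (cliques_meeting E W v) = 2 ^ card (closed_nbhd E W v) - 1"
    and u: "u \<in> closed_nbhd E W v" "y \<in> W" "(u, y) \<in> E"
  shows "y \<in> closed_nbhd E W v"
proof -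
  have sub: "Pow (closed_nbhd E W v) - {{}} \<subseteq> cliques_meeting E W v"
    using N by (auto simp: cliques_meeting_def cliques_in_def)
  have "card (Pow (closed_nbhd E W v) - {{}}) = 2 ^ card (closed_nbhd E W v) - 1"
    using finite_closed_nbhd[OF assms(1), of E v] by (simp add: card_Pow)
  then have "Pow (closed_nbhd E W v) - {{}} = cliques_meeting E W v"
    using card_subset_eq[OF _ sub] c assms(1) by (simp add: cliques_meeting_def finite_cliques_in)
  moreover have "{u, y} \<in> cliques_meeting E W v"
    using u sym_E by (auto simp: cliques_meeting_def cliques_in_def closed_nbhd_def)
  ultimately have "{u, y} \<in> Pow (closed_nbhd E W v)" by (metis DiffD1)
  then show ?thesis by simp
qed

text \<open>Without triangles the cliques are the empty set, the vertices and the edges. Counting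
  edges at both ends shows that a 2-regular graph has as many edges as vertices.\<close>

lemma card_cliques_in_two_regular:
  assumes "finite W"
    and reg: "\<And>w. w \<in> W \<Longrightarrow>
      \<exists>x y. closed_nbhd E W w = {w, x, y} \<and> x \<noteq> y \<and> x \<noteq> w \<and> y \<noteq> w \<and> (x, y) \<notin> E"
  shows "card (cliques_in E W) = 1 + 2 * card W"
proof -
  define F where "F = {K \<in> cliques_in E W. card K = 2}"
  have finF: "finite F" using assms(1) by (simp add: F_def finite_cliques_in)
  have small: "S = {} \<or> (\<exists>w\<in>W. S = {w}) \<or> card S = 2" if S: "S \<in> cliques_in E W" for S
  proof (cases "S = {}")
    case False
    then obtain w where w: "w \<in> S" by blast
    then have "w \<in> W" using S by (auto simp: cliques_in_def)
    from reg[OF this] obtain x y where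
      N: "closed_nbhd E W w = {w, x, y}" "x \<noteq> y" "x \<noteq> w" "y \<noteq> w" "(x, y) \<notin> E" by blast
    have "S \<subseteq> closed_nbhd E W w"
      using S w by (auto simp: closed_nbhd_def cliques_in_def)
    moreover have "\<not> (x \<in> S \<and> y \<in> S)" using N cliques_inD[OF S] by blast
    ultimately have "S = {w} \<or> S = {w, x} \<or> S = {w, y}" using w N(1) by auto
    then show ?thesis using \<open>w \<in> W\<close> N by auto
  qed simp
  have split: "cliques_in E W = insert {} ((\<lambda>w. {w}) ` W \<union> F)"
  proof
    show "cliques_in E W \<subseteq> insert {} ((\<lambda>w. {w}) ` W \<union> F)"
      using small by (auto simp: F_def)
    show "insert {} ((\<lambda>w. {w}) ` W \<union> F) \<subseteq> cliques_in E W"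
      by (auto simp: F_def cliques_in_def)
  qed
  have "card {K \<in> F. w \<in> K} = 2" if w: "w \<in> W" for w
  proof -
    from reg[OF w] obtain x y where
      N: "closed_nbhd E W w = {w, x, y}" "x \<noteq> y" "x \<noteq> w" "y \<noteq> w" by blast
    have xy: "x \<in> W" "y \<in> W" "(w, x) \<in> E" "(w, y) \<in> E"
    proof -
      have "x \<in> closed_nbhd E W w" "y \<in> closed_nbhd E W w" using N by auto
      then show "x \<in> W" "y \<in> W" "(w, x) \<in> E" "(w, y) \<in> E"
        using N by (auto simp: closed_nbhd_def)
    qed
    have "{K \<in> F. w \<in> K} = {{w, x}, {w, y}}"
    proof
      show "{K \<in> F. w \<in> K} \<subseteq> {{w, x}, {w, y}}"
      proof
        fix K assume "K \<in> {K \<in> F. w \<in> K}"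
        then have K: "K \<in> cliques_in E W" "card K = 2" "w \<in> K" by (auto simp: F_def)
        then obtain u where u: "K = {w, u}" "u \<noteq> w"
          by (metis card_2_iff insertE insert_commute singletonD)
        then have "u \<in> closed_nbhd E W w"
          using K by (auto simp: cliques_in_def closed_nbhd_def)
        then show "K \<in> {{w, x}, {w, y}}" using u N by auto
      qed
      show "{{w, x}, {w, y}} \<subseteq> {K \<in> F. w \<in> K}"
        using w xy N sym_E by (auto simp: F_def cliques_in_def)
    qed
    moreover have "{w, x} \<noteq> {w, y}" using N by (auto simp: doubleton_eq_iff)
    ultimately show ?thesis by simp
  qed
  then have "(\<Sum>w\<in>W. card {K \<in> F. w \<in> K}) = 2 * card W" by simp
  moreover have "(\<Sum>w\<in>W. card {K \<in> F. w \<in> K}) = 2 * card F"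
  proof (rule sum_multicount[OF assms(1) finF], rule ballI)
    fix K assume "K \<in> F"
    then have "{w \<in> W. w \<in> K} = K" "card K = 2" by (auto simp: F_def cliques_in_def)
    then show "card {w \<in> W. w \<in> K} = 2" by simp
  qed
  ultimately have "card F = card W" by simp
  moreover have "card ((\<lambda>w. {w}) ` W \<union> F) = card ((\<lambda>w. {w}) ` W) + card F"
    using finF assms(1) by (intro card_Un_disjoint) (auto simp: F_def)
  moreover have "card ((\<lambda>w. {w}) ` W) = card W" by (intro card_image) auto
  moreover have "{} \<notin> (\<lambda>w. {w}) ` W \<union> F" by (auto simp: F_def)
  ultimately show ?thesis
    unfolding split using finF assms(1) by (subst card_insert_disjoint) auto
qed

end

section \<open>Isomorphism with the extremal graphs\<close>

text \<open>A vertex map alone suffices here and can be glued from pieces;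
  \<open>graph_iso_iff_induced_iso\<close> relates it to the library notion, which also carries an
  arc map.\<close>

definition induced_iso :: "'a rel \<Rightarrow> 'a set \<Rightarrow> 'b pair_pre_digraph \<Rightarrow> bool" where
  "induced_iso E W H \<longleftrightarrow> (\<exists>f. bij_betw f W (pverts H) \<and>
     (\<forall>u\<in>W. \<forall>v\<in>W. (u, v) \<in> E \<longleftrightarrow> (f u, f v) \<in> parcs H))"

lemma pverts_simps [simp]:
  "pverts (complete_graph m) = {..<m}"
  "pverts (cycle_graph m) = {..<m}"
  "pverts (disjoint_copies a G) = {..<a} \<times> pverts G"
  "pverts (disjoint_union G H) = pverts G <+> pverts H"
  by (simp_all add: complete_graph_def cycle_graph_def disjoint_copies_def disjoint_union_def)

lemma parcs_simps [simp]:
  "(u, v) \<in> parcs (complete_graph m) \<longleftrightarrow> u < m \<and> v < m \<and> u \<noteq> v"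
  "(u, v) \<in> parcs (cycle_graph m) \<longleftrightarrow> u < m \<and> v < m \<and> (v = Suc u mod m \<or> u = Suc v mod m)"
  "((i, x), (j, y)) \<in> parcs (disjoint_copies a G) \<longleftrightarrow> i = j \<and> i < a \<and> (x, y) \<in> parcs G"
  "(Inl p, Inl q) \<in> parcs (disjoint_union G H) \<longleftrightarrow> (p, q) \<in> parcs G"
  "(Inr s, Inr t) \<in> parcs (disjoint_union G H) \<longleftrightarrow> (s, t) \<in> parcs H"
  "(Inl p, Inr t) \<notin> parcs (disjoint_union G H)"
  "(Inr s, Inl q) \<notin> parcs (disjoint_union G H)"
  by (auto simp: complete_graph_def cycle_graph_def disjoint_copies_def disjoint_union_def)

lemma card_eq_if_induced_iso: "induced_iso E W H \<Longrightarrow> card W = card (pverts H)"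
  by (auto simp: induced_iso_def dest: bij_betw_same_card)

lemma card_pverts_union_copies:
  "finite (pverts H) \<Longrightarrow>
    card (pverts (disjoint_union (disjoint_copies a (complete_graph m)) H)) = a * m + card (pverts H)"
  by (simp add: card_Plus card_cartesian_product)

text \<open>Brings a graph that is just a cycle into the shape of a union with zero copies.\<close>

lemma induced_iso_no_copies:
  assumes "induced_iso E W H"
  shows "induced_iso E W (disjoint_union (disjoint_copies 0 K) H)"
proof -
  obtain f where f: "bij_betw f W (pverts H)"
    "\<forall>u\<in>W. \<forall>v\<in>W. (u, v) \<in> E \<longleftrightarrow> (f u, f v) \<in> parcs H"
    using assms by (auto simp: induced_iso_def)
  have "bij_betw (Inr \<circ> f) W (pverts (disjoint_union (disjoint_copies 0 K) H))"
    using f(1) by (auto simp: bij_betw_def inj_on_def)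
  then show ?thesis
    using f(2) unfolding induced_iso_def by (intro exI[of _ "Inr \<circ> f"]) simp
qed

context simple_rel
begin

lemma induced_iso_add_copy:
  assumes C: "C \<in> cliques_in E W" "finite C" "card C = m"
    and iso: "\<And>u v. u \<in> C \<Longrightarrow> v \<in> W - C \<Longrightarrow> (u, v) \<notin> E"
    and rest: "induced_iso E (W - C) (disjoint_union (disjoint_copies a (complete_graph m)) H)"
  shows "induced_iso E W (disjoint_union (disjoint_copies (Suc a) (complete_graph m)) H)"
proof -
  let ?H = "disjoint_union (disjoint_copies a (complete_graph m)) H"
  let ?H' = "disjoint_union (disjoint_copies (Suc a) (complete_graph m)) H"
  obtain f where f: "bij_betw f (W - C) (pverts ?H)"
    and fE: "\<And>u v. u \<in> W - C \<Longrightarrow> v \<in> W - C \<Longrightarrow> (u, v) \<in> E \<longleftrightarrow> (f u, f v) \<in> parcs ?H"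
    using rest by (auto simp: induced_iso_def)
  obtain g where g: "bij_betw g C {0..<m}"
    using ex_bij_betw_finite_nat[OF C(2)] C(3) by auto
  \<comment> \<open>The component \<open>C\<close> becomes the copy with index \<open>a\<close>, the
    first one not in use.\<close>
  define h where "h = (\<lambda>w. if w \<in> C then Inl (a, g w) else f w)"
  have CW: "C \<subseteq> W" using C by (auto simp: cliques_in_def)
  have "bij_betw h C (Inl ` ({a} \<times> {..<m}))"
    using g by (auto simp: bij_betw_def inj_on_def h_def image_iff)
  moreover have "bij_betw h (W - C) (pverts ?H)"
    using f by (rule bij_betw_cong[THEN iffD1, rotated]) (simp add: h_def)
  moreover have "Inl ` ({a} \<times> {..<m}) \<inter> pverts ?H = {}" by auto
  ultimately have "bij_betw h (C \<union> (W - C)) (Inl ` ({a} \<times> {..<m}) \<union> pverts ?H)"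
    by (rule bij_betw_combine)
  moreover have "Inl ` ({a} \<times> {..<m}) \<union> pverts ?H = pverts ?H'" by auto
  moreover have "C \<union> (W - C) = W" using CW by auto
  ultimately have bij: "bij_betw h W (pverts ?H')" by simp
  have old: "f u \<in> pverts ?H" if "u \<in> W - C" for u
    using f that by (auto simp: bij_betw_def)
  have arcs_old: "(p, q) \<in> parcs ?H' \<longleftrightarrow> (p, q) \<in> parcs ?H" if "p \<in> pverts ?H" "q \<in> pverts ?H" for p q
    using that by auto
  have arcs_cross: "(Inl (a, i), q) \<notin> parcs ?H'" "(q, Inl (a, i)) \<notin> parcs ?H'"
    if "q \<in> pverts ?H" for q i
    using that by auto
  have "(u, v) \<in> E \<longleftrightarrow> (h u, h v) \<in> parcs ?H'" if uv: "u \<in> W" "v \<in> W" for u v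
  proof -
    consider "u \<in> C" "v \<in> C" | "u \<in> C" "v \<in> W - C" | "u \<in> W - C" "v \<in> C" | "u \<in> W - C" "v \<in> W - C"
      using uv by blast
    then show ?thesis
    proof cases
      case 1
      then have "g u < m" "g v < m" "g u = g v \<longleftrightarrow> u = v"
        using g by (auto simp: bij_betw_def inj_on_def)
      then show ?thesis
        using 1 cliques_inD[OF C(1)] irrefl_E by (auto simp: h_def)
    next
      case 2
      then show ?thesis using iso arcs_cross[OF old[of v]] by (simp add: h_def)
    next
      case 3
      then show ?thesis using iso sym_E arcs_cross[OF old[of u]] by (auto simp: h_def)
    next
      case 4
      then show ?thesis using fE arcs_old[OF old old, of u v] by (simp add: h_def)
    qed
  qed
  then show ?thesis using bij unfolding induced_iso_def by blast
qed

text \<open>The gluing of \<open>induced_iso_add_copy\<close> again, but now \<open>C\<close> fills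
  the right summand, still empty as \<open>complete_graph 0\<close>.\<close>

lemma induced_iso_add_remainder:
  assumes C: "C \<in> cliques_in E W" "finite C" "card C = b"
    and iso: "\<And>u v. u \<in> C \<Longrightarrow> v \<in> W - C \<Longrightarrow> (u, v) \<notin> E"
    and rest: "induced_iso E (W - C) (disjoint_union H (complete_graph 0))"
  shows "induced_iso E W (disjoint_union H (complete_graph b))"
proof -
  let ?H = "disjoint_union H (complete_graph 0)"
  let ?H' = "disjoint_union H (complete_graph b)"
  obtain f where f: "bij_betw f (W - C) (pverts ?H)"
    and fE: "\<And>u v. u \<in> W - C \<Longrightarrow> v \<in> W - C \<Longrightarrow> (u, v) \<in> E \<longleftrightarrow> (f u, f v) \<in> parcs ?H"
    using rest by (auto simp: induced_iso_def)
  obtain g where g: "bij_betw g C {0..<b}"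
    using ex_bij_betw_finite_nat[OF C(2)] C(3) by auto
  define h where "h = (\<lambda>w. if w \<in> C then Inr (g w) else f w)"
  have CW: "C \<subseteq> W" using C by (auto simp: cliques_in_def)
  have "bij_betw h C (Inr ` {..<b})"
    using g by (auto simp: bij_betw_def inj_on_def h_def image_iff)
  moreover have "bij_betw h (W - C) (pverts ?H)"
    using f by (rule bij_betw_cong[THEN iffD1, rotated]) (simp add: h_def)
  moreover have "Inr ` {..<b} \<inter> pverts ?H = {}" by auto
  ultimately have "bij_betw h (C \<union> (W - C)) (Inr ` {..<b} \<union> pverts ?H)"
    by (rule bij_betw_combine)
  moreover have "Inr ` {..<b} \<union> pverts ?H = pverts ?H'" by auto
  moreover have "C \<union> (W - C) = W" using CW by auto
  ultimately have bij: "bij_betw h W (pverts ?H')" by simp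
  have old: "f u \<in> pverts ?H" if "u \<in> W - C" for u
    using f that by (auto simp: bij_betw_def)
  have arcs_old: "(p, q) \<in> parcs ?H' \<longleftrightarrow> (p, q) \<in> parcs ?H" if "p \<in> pverts ?H" "q \<in> pverts ?H" for p q
    using that by auto
  have arcs_cross: "(Inr i, q) \<notin> parcs ?H'" "(q, Inr i) \<notin> parcs ?H'"
    if "q \<in> pverts ?H" for q i
    using that by auto
  have "(u, v) \<in> E \<longleftrightarrow> (h u, h v) \<in> parcs ?H'" if uv: "u \<in> W" "v \<in> W" for u v
  proof -
    consider "u \<in> C" "v \<in> C" | "u \<in> C" "v \<in> W - C" | "u \<in> W - C" "v \<in> C" | "u \<in> W - C" "v \<in> W - C"
      using uv by blast
    then show ?thesis
    proof cases
      case 1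
      then have "g u < b" "g v < b" "g u = g v \<longleftrightarrow> u = v"
        using g by (auto simp: bij_betw_def inj_on_def)
      then show ?thesis
        using 1 cliques_inD[OF C(1)] irrefl_E by (auto simp: h_def)
    next
      case 2
      then show ?thesis using iso arcs_cross[OF old[of v]] by (simp add: h_def)
    next
      case 3
      then show ?thesis using iso sym_E arcs_cross[OF old[of u]] by (auto simp: h_def)
    next
      case 4
      then show ?thesis using fE arcs_old[OF old old, of u v] by (simp add: h_def)
    qed
  qed
  then show ?thesis using bij unfolding induced_iso_def by blast
qed

text \<open>Reduces the recognition of a short cycle to listing its vertices in cyclic order and
  checking finitely many index pairs.\<close>

lemma induced_isoI_list:
  assumes "distinct l" "set l = W" "pverts H = {..<length l}"
    and "\<And>i j. i < length l \<Longrightarrow> j < length l \<Longrightarrow> (l ! i, l ! j) \<in> E \<longleftrightarrow> (i, j) \<in> parcs H"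
  shows "induced_iso E W H"
proof -
  have b: "bij_betw ((!) l) {..<length l} W"
    using assms(1,2) bij_betw_nth by blast
  define f where "f = the_inv_into {..<length l} ((!) l)"
  have "bij_betw f W (pverts H)"
    unfolding f_def assms(3) by (rule bij_betw_the_inv_into[OF b])
  moreover have "(u, v) \<in> E \<longleftrightarrow> (f u, f v) \<in> parcs H" if "u \<in> W" "v \<in> W" for u v
  proof -
    have "l ! f u = u" "l ! f v = v"
      unfolding f_def using b that by (auto simp: bij_betw_def intro: f_the_inv_into_f)
    moreover have "f u < length l" "f v < length l"
      using \<open>bij_betw f W (pverts H)\<close> that assms(3) by (auto simp: bij_betw_def)
    ultimately show ?thesis using assms(4) by metis
  qed
  ultimately show ?thesis unfolding induced_iso_def by blast
qed

text \<open>Walk from \<open>v\<close> in both directions, through \<open>x\<close> to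
  \<open>p\<close> and through \<open>y\<close> to \<open>q\<close>. The walks close up to a 4-cycle
  if \<open>p = q\<close>; otherwise five vertices are found and the edge between \<open>p\<close>
  and \<open>q\<close> is forced.\<close>

lemma two_regular_iso_cycle:
  assumes "finite W"
    and reg: "\<And>w. w \<in> W \<Longrightarrow>
      \<exists>x y. closed_nbhd E W w = {w, x, y} \<and> x \<noteq> y \<and> x \<noteq> w \<and> y \<noteq> w \<and> (x, y) \<notin> E"
    and card: "card W = m" "m = 4 \<or> m = 5"
  shows "induced_iso E W (cycle_graph m)"
proof -
  have nb: "(w, u) \<in> E \<longleftrightarrow> u \<in> closed_nbhd E W w - {w}" if "u \<in> W" for u w
    using that irrefl_E by (auto simp: closed_nbhd_def)
  have other: "\<exists>p. closed_nbhd E W w = {w, u, p} \<and> p \<noteq> u \<and> p \<noteq> w \<and> (u, p) \<notin> E \<and> p \<in> W"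
    if w: "w \<in> W" "u \<in> W" "(w, u) \<in> E" for w u
  proof -
    obtain x y where N: "closed_nbhd E W w = {w, x, y}" "x \<noteq> y" "x \<noteq> w" "y \<noteq> w" "(x, y) \<notin> E"
      using reg[OF w(1)] by blast
    have "u = x \<or> u = y" using nb[OF w(2), of w] w(3) N(1) by auto
    moreover have "x \<in> W" "y \<in> W" using N(1) closed_nbhd_subset[of E W w] by auto
    ultimately show ?thesis using N sym_E by (metis insert_commute)
  qed
  have "W \<noteq> {}" using card by auto
  then obtain v where v: "v \<in> W" by blast
  obtain x y where Nv: "closed_nbhd E W v = {v, x, y}" "x \<noteq> y" "x \<noteq> v" "y \<noteq> v" "(x, y) \<notin> E"
    using reg[OF v] by blast
  have xy: "x \<in> W" "y \<in> W" using Nv(1) closed_nbhd_subset[of E W v] by auto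
  then have "(v, x) \<in> E" "(v, y) \<in> E" using nb[of _ v] Nv by auto
  then have "(x, v) \<in> E" "(y, v) \<in> E" by (auto intro: sym_E)
  obtain p where p: "closed_nbhd E W x = {x, v, p}" "p \<noteq> v" "p \<noteq> x" "(v, p) \<notin> E" "p \<in> W"
    using other[OF xy(1) v \<open>(x, v) \<in> E\<close>] by blast
  obtain q where q: "closed_nbhd E W y = {y, v, q}" "q \<noteq> v" "q \<noteq> y" "(v, q) \<notin> E" "q \<in> W"
    using other[OF xy(2) v \<open>(y, v) \<in> E\<close>] by blast
  have py: "p \<noteq> y" using p(4) \<open>(v, y) \<in> E\<close> by auto
  have qx: "q \<noteq> x" using q(4) \<open>(v, x) \<in> E\<close> by auto
  have px: "(p, x) \<in> E" using nb[OF p(5), of x] p by (auto intro: sym_E)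
  have qy: "(q, y) \<in> E" using nb[OF q(5), of y] q by (auto intro: sym_E)
  obtain s where s: "closed_nbhd E W p = {p, x, s}" "s \<noteq> x" "s \<noteq> p" "s \<in> W"
    using other[OF p(5) xy(1) px] by blast
  show ?thesis
  proof (cases "p = q")
    case True
    have "y \<in> closed_nbhd E W p" using qy True xy by (simp add: closed_nbhd_def)
    then have Np: "closed_nbhd E W p = {p, x, y}" using s(1) Nv(2) py by auto
    have sub: "W \<subseteq> {v, x, p, y}"
    \<comment> \<open>The 4-cycle has no free degrees left, so a further vertex \<open>t\<close>
      would bring two further neighbours: seven vertices where at most five exist.\<close>
    proof (rule subsetI, rule ccontr)
      fix t assume t: "t \<in> W" "t \<notin> {v, x, p, y}"
      obtain t1 t2 where T: "closed_nbhd E W t = {t, t1, t2}" "t1 \<noteq> t2" "t1 \<noteq> t" "t2 \<noteq> t"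
        using reg[OF t(1)] by blast
      have tW: "t1 \<in> W" "t2 \<in> W" using T(1) closed_nbhd_subset[of E W t] by auto
      have tE: "(t1, t) \<in> E" "(t2, t) \<in> E"
        using nb[OF tW(1), of t] nb[OF tW(2), of t] T by (auto intro: sym_E)
      have "u \<notin> {v, x, p, y}" if "(u, t) \<in> E" for u
        using nb[OF t(1), of u] that t(2) Nv(1) p(1) q(1) Np True by auto
      then have "t1 \<notin> {v, x, p, y}" "t2 \<notin> {v, x, p, y}" using tE by blast+
      then have "card {v, x, p, y, t, t1, t2} = 7"
        using t(2) T Nv p py by auto
      moreover have "card {v, x, p, y, t, t1, t2} \<le> card W"
        using v xy p(5) t(1) tW assms(1) by (intro card_mono) auto
      ultimately show False using card by auto
    qed
    have W: "set [v, x, p, y] = W" using sub v xy p(5) by auto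
    have dist: "distinct [v, x, p, y]" using Nv p py by auto
    have "m = 4" using distinct_card[OF dist] W card by simp
    have "induced_iso E W (cycle_graph 4)"
    proof (rule induced_isoI_list[OF dist W])
      show "pverts (cycle_graph 4) = {..<length [v, x, p, y]}" by simp
      fix i j assume "i < length [v, x, p, y]" "j < length [v, x, p, y]"
      then have "i \<in> {0, 1, 2, 3}" "j \<in> {0, 1, 2, 3}" by auto
      then show "([v, x, p, y] ! i, [v, x, p, y] ! j) \<in> E \<longleftrightarrow> (i, j) \<in> parcs (cycle_graph 4)"
        using nb[OF v] nb[OF xy(1)] nb[OF xy(2)] nb[OF p(5)] Nv(1) p(1) q(1) Np True dist
        by (elim insertE; simp) (auto simp: insert_Diff_if)
    qed
    then show ?thesis using \<open>m = 4\<close> by simp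
  next
    case False
    have dist: "distinct [v, x, p, q, y]" using Nv p q py qx False by auto
    have sub: "set [v, x, p, q, y] \<subseteq> W" using v xy p(5) q(5) by auto
    have le: "card (set [v, x, p, q, y]) = 5" using distinct_card[OF dist] by simp
    have W: "set [v, x, p, q, y] = W"
      using card_subset_eq[OF assms(1) sub] le card card_mono[OF assms(1) sub] by auto
    have "m = 5" using le W card by simp
    have ps: "(s, p) \<in> E" using nb[OF s(4), of p] s by (auto intro: sym_E)
    \<comment> \<open>Both vertices already have their two neighbours, and \<open>p\<close> is not
      among them; so the second neighbour \<open>s\<close> of \<open>p\<close> can only be
      \<open>q\<close>.\<close>
    have "s \<noteq> v" "s \<noteq> y"
      using ps nb[OF p(5), of v] nb[OF p(5), of y] Nv(1) q(1) dist by auto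
    then have "s = q" using s W by auto
    then have Np: "closed_nbhd E W p = {p, x, q}" using s by simp
    have "(q, p) \<in> E" using ps \<open>s = q\<close> by simp
    from other[OF q(5) xy(2) qy] have Nq: "closed_nbhd E W q = {q, y, p}"
      using nb[OF p(5), of q] \<open>(q, p) \<in> E\<close> py by auto
    have "induced_iso E W (cycle_graph 5)"
    proof (rule induced_isoI_list[OF dist W])
      show "pverts (cycle_graph 5) = {..<length [v, x, p, q, y]}" by simp
      fix i j assume "i < length [v, x, p, q, y]" "j < length [v, x, p, q, y]"
      then have "i \<in> {0, 1, 2, 3, 4}" "j \<in> {0, 1, 2, 3, 4}" by auto
      then show "([v, x, p, q, y] ! i, [v, x, p, q, y] ! j) \<in> E \<longleftrightarrow> (i, j) \<in> parcs (cycle_graph 5)"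
        using nb[OF v] nb[OF xy(1)] nb[OF xy(2)] nb[OF p(5)] nb[OF q(5)] Nv(1) p(1) q(1) Np Nq dist
        by (elim insertE; simp) (auto simp: insert_Diff_if)
    qed
    then show ?thesis using \<open>m = 5\<close> by simp
  qed
qed

end

section \<open>Structure of the graphs attaining the bound\<close>

abbreviation (input) union_complete :: "nat \<Rightarrow> nat \<Rightarrow> nat \<Rightarrow> (nat \<times> nat + nat) pair_pre_digraph" where
  "union_complete a m b \<equiv> disjoint_union (disjoint_copies a (complete_graph m)) (complete_graph b)"

abbreviation (input) union_cycle :: "nat \<Rightarrow> nat \<Rightarrow> (nat \<times> nat + nat) pair_pre_digraph" where
  "union_cycle a m \<equiv> disjoint_union (disjoint_copies a (complete_graph 3)) (cycle_graph m)"

text \<open>Induction by splitting off components. If some closed neighbourhood is a clique,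
  tightness isolates it and gives it \<open>r + 1\<close> or \<open>b\<close> vertices, so it is a
  new copy or the final complete graph. Otherwise the graph is 2-regular and triangle-free, and
  comparing its clique count with the extremal one leaves only the two cycles.\<close>

lemma (in simple_rel) extremal_structure:
  assumes "finite W" and "\<And>v. v \<in> W \<Longrightarrow> card (closed_nbhd E W v) \<le> r + 1"
    and "card W = a * (r + 1) + b" "b \<le> r"
    and "card (cliques_in E W) = extremal_count r (card W)"
  shows "induced_iso E W (union_complete a (r + 1) b) \<or>
    r = 2 \<and> 1 \<le> a \<and> (induced_iso E W (union_cycle (a - 1) 4) \<or> induced_iso E W (union_cycle (a - 1) 5))"
  using assms
proof (induction "card W" arbitrary: W a b rule: less_induct)
  case less
  note fin = less.prems(1) and deg = less.prems(2) and n = less.prems(3) and b = less.prems(4)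
  note tight = extremal_tight[OF less.prems(1,2) less.prems(5)]
  have amod: "card W mod (r + 1) = b"
    unfolding n using b by (subst mod_mult_self3) simp
  show ?case
  proof (cases "W = {}")
    case True
    then have "a = 0" "b = 0" using n by auto
    then show ?thesis using True by (auto simp: induced_iso_def bij_betw_def)
  next
    case nonempty: False
    show ?thesis
    proof (cases "\<exists>v\<in>W. closed_nbhd E W v \<in> cliques_in E W")
      case True
      then obtain v where v: "v \<in> W" "closed_nbhd E W v \<in> cliques_in E W" by blast
      define C where "C = closed_nbhd E W v"
      have C: "C \<in> cliques_in E W" "finite C"
        using v finite_closed_nbhd[OF fin] by (auto simp: C_def)
      have "v \<in> C" using v by (simp add: C_def closed_nbhd_def)
      then have "card C \<noteq> 0" using C by auto
      note t = tight[OF _ v(1), folded C_def]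
      have iso: "(u, y) \<notin> E" if "u \<in> C" "y \<in> W - C" for u y
        using clique_closed_nbhd_isolated[OF fin v tight(2)[OF _ v(1)], of u y] that deg
        by (auto simp: C_def)
      have CW: "card C \<le> card W" unfolding C_def by (intro card_mono fin closed_nbhd_subset)
      have cW: "card (W - C) = card W - card C" using t(5) deg by blast
      have fin': "finite (W - C)" using fin by simp
      have deg': "card (closed_nbhd E (W - C) u) \<le> r + 1" if "u \<in> W - C" for u
        using that deg fin by (intro card_closed_nbhd_Diff_le) auto
      have lt: "card (W - C) < card W" using cW CW \<open>card C \<noteq> 0\<close> by linarith
      have ext': "card (cliques_in E (W - C)) = extremal_count r (card (W - C))"
        using t(3) deg by blast
      have IH: "induced_iso E (W - C) (union_complete a (r + 1) b) \<or> r = 2 \<and> 1 \<le> a \<and>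
          (induced_iso E (W - C) (union_cycle (a - 1) 4) \<or> induced_iso E (W - C) (union_cycle (a - 1) 5))"
        if "card (W - C) = a * (r + 1) + b" "b \<le> r" for a b
        using less.hyps[OF lt fin' deg' that ext'] by blast
      show ?thesis
      proof (cases "card C = r + 1")
        case True
        have "a \<noteq> 0"
        proof
          assume "a = 0"
          then show False using CW True n b by simp
        qed
        then obtain a' where a': "a = Suc a'" using not0_implies_Suc by blast
        have "card (W - C) = a' * (r + 1) + b" using cW n True a' by simp
        from IH[OF this b]
        consider "induced_iso E (W - C) (union_complete a' (r + 1) b)"
          | m where "r = 2" "1 \<le> a'" "m = 4 \<or> m = 5" "induced_iso E (W - C) (union_cycle (a' - 1) m)"
          by auto
        then show ?thesis
        proof cases
          case 1
          then show ?thesis unfolding a' using induced_iso_add_copy[OF C True iso] by blast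
        next
          case 2
          \<comment> \<open>Since \<open>1 \<le> a'\<close>, the index \<open>Suc (a' - 1)\<close>
            is \<open>a'\<close>, which is \<open>a - 1\<close>.\<close>
          then have "induced_iso E W (union_cycle (Suc (a' - 1)) m)"
            using True by (intro induced_iso_add_copy[OF C _ iso]) auto
          then show ?thesis using 2 a' by auto
        qed
      next
        case False
        then have Cb: "card C = b" using t(4) amod deg by blast
        have c0: "card (W - C) = a * (r + 1) + 0" using cW n Cb by simp
        \<comment> \<open>The rest has \<open>3 * a\<close> vertices, whereas triangles with a
          4-cycle or 5-cycle never give a multiple of 3.\<close>
        have "\<not> induced_iso E (W - C) (union_cycle (a - 1) m)"
          if "r = 2" "1 \<le> a" "m = 4 \<or> m = 5" for m
        proof
          assume "induced_iso E (W - C) (union_cycle (a - 1) m)"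
          then have "card (W - C) = (a - 1) * 3 + m"
            using card_eq_if_induced_iso card_pverts_union_copies[of "cycle_graph m" "a - 1" 3]
            by fastforce
          then show False using c0 that by auto
        qed
        then have "induced_iso E (W - C) (union_complete a (r + 1) 0)"
          using IH[OF c0] by blast
        then show ?thesis using induced_iso_add_remainder[OF C Cb iso] by blast
      qed
    next
      case False
      obtain v where v: "v \<in> W" using nonempty by blast
      have reg: "\<exists>x y. closed_nbhd E W w = {w, x, y} \<and> x \<noteq> y \<and> x \<noteq> w \<and> y \<noteq> w \<and> (x, y) \<notin> E"
        if "w \<in> W" for w
        using closed_nbhd_if_balanced[OF fin tight(1)[OF _ v] that] deg False that by metis
      have "card (cliques_in E W) = 1 + 2 * card W"
        using fin reg by (rule card_cliques_in_two_regular)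
      then have eq: "extremal_count r (card W) = 1 + 2 * card W"
        using less.prems(5) by simp
      have "2 \<le> r"
      proof -
        obtain x y where "closed_nbhd E W v = {v, x, y}" "x \<noteq> y" "x \<noteq> v" "y \<noteq> v"
          using reg[OF v] by blast
        then show ?thesis using deg[OF v] by auto
      qed
      moreover have "0 < card W" using v fin by (auto simp: card_gt_0_iff)
      ultimately have r: "r = 2" and W: "card W = 4 \<or> card W = 5"
        using extremal_count_eq_twice_plus_one[OF eq] by auto
      have "card W = a * 3 + b" "b \<le> 2" using n b r by simp_all
      then have "a = 1" using W by linarith
      have "induced_iso E W (cycle_graph (card W))"
        using fin reg refl W by (rule two_regular_iso_cycle)
      then have "induced_iso E W (union_cycle 0 (card W))"
        by (rule induced_iso_no_copies)
      then show ?thesis using W r \<open>a = 1\<close> by auto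
    qed
  qed
qed

section \<open>Clique counts of the extremal graphs\<close>

lemma card_cliques_in_iso:
  assumes "bij_betw f W W'"
    and "\<And>u v. u \<in> W \<Longrightarrow> v \<in> W \<Longrightarrow> (u, v) \<in> E \<longleftrightarrow> (f u, f v) \<in> E'"
  shows "card (cliques_in E W) = card (cliques_in E' W')"
proof -
  have inj: "inj_on f W" and im: "f ` W = W'" using assms(1) by (auto simp: bij_betw_def)
  have "(`) f ` cliques_in E W = cliques_in E' W'"
  proof (rule set_eqI, rule iffI)
    fix T assume "T \<in> (`) f ` cliques_in E W"
    then obtain S where S: "S \<in> cliques_in E W" "T = f ` S" by blast
    then have "S \<subseteq> W" by (simp add: cliques_in_def)
    have "(f u, f v) \<in> E'" if "u \<in> S" "v \<in> S" "f u \<noteq> f v" for u v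
      using that cliques_inD[OF S(1), of u v] assms(2)[of u v] \<open>S \<subseteq> W\<close> by blast
    then show "T \<in> cliques_in E' W'"
      using S(2) \<open>S \<subseteq> W\<close> im by (auto simp: cliques_in_def)
  next
    fix T assume T: "T \<in> cliques_in E' W'"
    define S where "S = {w \<in> W. f w \<in> T}"
    have "f ` S = T" using T im by (auto simp: S_def cliques_in_def)
    moreover have "(u, v) \<in> E" if "u \<in> S" "v \<in> S" "u \<noteq> v" for u v
    proof -
      have "f u \<noteq> f v" using that inj by (auto simp: S_def dest: inj_onD)
      then have "(f u, f v) \<in> E'" using that cliques_inD[OF T] by (simp add: S_def)
      then show ?thesis using that assms(2) by (simp add: S_def)
    qed
    then have "S \<in> cliques_in E W" by (auto simp: cliques_in_def S_def)
    ultimately show "T \<in> (`) f ` cliques_in E W" by (metis image_eqI)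
  qed
  moreover have "inj_on ((`) f) (cliques_in E W)"
    using inj_on_image_Pow[OF inj] cliques_in_subset_Pow by (rule inj_on_subset)
  ultimately show ?thesis using card_image by metis
qed

text \<open>No clique meets both sides; the \<open>+ 1\<close> compensates for the empty clique,
  which both sides count.\<close>

lemma card_cliques_in_Un:
  assumes "finite A" "finite B" "A \<inter> B = {}"
    and "\<And>u v. u \<in> A \<Longrightarrow> v \<in> B \<Longrightarrow> (u, v) \<notin> E"
  shows "card (cliques_in E (A \<union> B)) + 1 = card (cliques_in E A) + card (cliques_in E B)"
proof -
  have "S \<subseteq> A \<or> S \<subseteq> B" if S: "S \<in> cliques_in E (A \<union> B)" for S
  proof (rule ccontr)
    assume "\<not> ?thesis"
    then obtain u v where uv: "u \<in> S" "u \<in> A" "v \<in> S" "v \<in> B"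
      using S by (auto simp: cliques_in_def)
    then have "u \<noteq> v" using assms(3) by blast
    then show False using uv assms(4) cliques_inD[OF S] by blast
  qed
  then have "cliques_in E (A \<union> B) = cliques_in E A \<union> cliques_in E B"
    by (auto simp: cliques_in_def)
  moreover have "cliques_in E A \<inter> cliques_in E B = {{}}"
    using assms(3) by (auto simp: cliques_in_def)
  ultimately show ?thesis
    using card_Un_Int[OF finite_cliques_in[OF assms(1)] finite_cliques_in[OF assms(2)], of E E] by simp
qed

definition clique_count :: "'a pair_pre_digraph \<Rightarrow> nat" where
  "clique_count H = card (cliques_in (parcs H) (pverts H))"

lemma clique_count_complete_graph: "clique_count (complete_graph m) = 2 ^ m"
proof -
  have "cliques_in (parcs (complete_graph m)) {..<m} = Pow {..<m}"
    by (auto simp: cliques_in_def)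
  then show ?thesis by (simp add: clique_count_def card_Pow)
qed

lemma clique_count_disjoint_union:
  assumes "finite (pverts G)" "finite (pverts H)"
  shows "clique_count (disjoint_union G H) + 1 = clique_count G + clique_count H"
proof -
  let ?E = "parcs (disjoint_union G H)"
  have "card (cliques_in ?E (Inl ` pverts G \<union> Inr ` pverts H)) + 1
      = card (cliques_in ?E (Inl ` pverts G)) + card (cliques_in ?E (Inr ` pverts H))"
    using assms by (intro card_cliques_in_Un) auto
  moreover have "card (cliques_in ?E (Inl ` pverts G)) = clique_count G"
    unfolding clique_count_def
    by (rule card_cliques_in_iso[of Inl, symmetric]) (auto simp: bij_betw_def)
  moreover have "card (cliques_in ?E (Inr ` pverts H)) = clique_count H"
    unfolding clique_count_def
    by (rule card_cliques_in_iso[of Inr, symmetric]) (auto simp: bij_betw_def)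
  ultimately show ?thesis by (simp add: clique_count_def Plus_def)
qed

lemma clique_count_disjoint_copies:
  assumes "finite (pverts G)"
  shows "clique_count (disjoint_copies a G) = a * (clique_count G - 1) + 1"
proof (induction a)
  case 0
  have "cliques_in (parcs (disjoint_copies 0 G)) {} = {{}}" by (auto simp: cliques_in_def)
  then show ?case by (simp add: clique_count_def)
next
  case (Suc a)
  let ?E = "parcs (disjoint_copies (Suc a) G)"
  have "card (cliques_in ?E ({..<a} \<times> pverts G \<union> {a} \<times> pverts G)) + 1
      = card (cliques_in ?E ({..<a} \<times> pverts G)) + card (cliques_in ?E ({a} \<times> pverts G))"
    using assms by (intro card_cliques_in_Un) auto
  moreover have "card (cliques_in ?E ({..<a} \<times> pverts G)) = clique_count (disjoint_copies a G)"
    unfolding clique_count_def by (rule card_cliques_in_iso[of id]) auto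
  moreover have "card (cliques_in ?E ({a} \<times> pverts G)) = clique_count G"
    unfolding clique_count_def
    by (rule card_cliques_in_iso[of "Pair a", symmetric]) (auto simp: bij_betw_def inj_on_def)
  moreover have "{..<a} \<times> pverts G \<union> {a} \<times> pverts G = pverts (disjoint_copies (Suc a) G)"
    by auto
  \<comment> \<open>Keeps the truncated subtraction in \<open>clique_count G - 1\<close>
    exact.\<close>
  moreover have "1 \<le> clique_count G"
    using empty_in_cliques_in finite_cliques_in[OF assms]
    by (auto simp: clique_count_def Suc_le_eq card_gt_0_iff)
  ultimately show ?case using Suc by (simp add: clique_count_def)
qed

lemma clique_count_union_complete:
  "clique_count (union_complete a (r + 1) b) = a * (2 ^ (r + 1) - 1) + 2 ^ b"
  using clique_count_disjoint_union[of "disjoint_copies a (complete_graph (r + 1))" "complete_graph b"]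
    clique_count_disjoint_copies[of "complete_graph (r + 1)" a] clique_count_complete_graph
  by simp

lemma simple_rel_cycle_graph: "2 \<le> m \<Longrightarrow> simple_rel (parcs (cycle_graph m))"
  by unfold_locales (auto simp: mod_Suc split: if_splits)

lemma clique_count_cycle_graph:
  assumes "m = 4 \<or> m = 5"
  shows "clique_count (cycle_graph m) = 1 + 2 * m"
proof -
  interpret simple_rel "parcs (cycle_graph m)"
    using assms by (intro simple_rel_cycle_graph) auto
  have "\<exists>x y. closed_nbhd (parcs (cycle_graph m)) {..<m} w = {w, x, y} \<and> x \<noteq> y \<and> x \<noteq> w \<and> y \<noteq> w \<and>
      (x, y) \<notin> parcs (cycle_graph m)" if "w \<in> {..<m}" for w
  proof (intro exI conjI)
    \<comment> \<open>Successor and predecessor on the cycle; adding \<open>m\<close> first keeps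
      the subtraction exact at \<open>w = 0\<close>.\<close>
    let ?x = "Suc w mod m" and ?y = "(w + m - 1) mod m"
    from that assms have "m = 4 \<and> w \<in> {0, 1, 2, 3} \<or> m = 5 \<and> w \<in> {0, 1, 2, 3, 4}"
      by auto
    then show "closed_nbhd (parcs (cycle_graph m)) {..<m} w = {w, ?x, ?y}"
      by (elim disjE conjE insertE; simp add: closed_nbhd_def) (auto simp: mod_Suc split: if_splits)
    from \<open>m = 4 \<and> w \<in> {0, 1, 2, 3} \<or> m = 5 \<and> w \<in> {0, 1, 2, 3, 4}\<close>
    show "?x \<noteq> ?y" "?x \<noteq> w" "?y \<noteq> w" "(?x, ?y) \<notin> parcs (cycle_graph m)"
      by (elim disjE conjE insertE; simp)+
  qed
  then show ?thesis
    unfolding clique_count_def using card_cliques_in_two_regular[of "{..<m}"] by simp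
qed

lemma clique_count_union_cycle:
  assumes "m = 4 \<or> m = 5"
  shows "clique_count (union_cycle a m) = 7 * a + 1 + 2 * m"
  using clique_count_disjoint_union[of "disjoint_copies a (complete_graph 3)" "cycle_graph m"]
    clique_count_disjoint_copies[of "complete_graph 3" a] clique_count_complete_graph[of 3]
    clique_count_cycle_graph[OF assms]
  by simp

section \<open>Translation between the library notions and the relational ones\<close>

lemma clique_iff_cliques_in:
  assumes "finite (pverts H)" "\<And>x. (x, x) \<notin> parcs H"
  shows "clique H S \<longleftrightarrow> S \<in> cliques_in (parcs H) (pverts H)"
proof (cases "S \<subseteq> pverts H")
  case True
  then have "finite S" using assms(1) finite_subset by blast
  have "with_proj H \<restriction> S = with_proj \<lparr>pverts = S, parcs = parcs H \<inter> S \<times> S\<rparr>"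
    by (auto simp: induce_subgraph_def with_proj_def)
  then have "clique H S \<longleftrightarrow> parcs H \<inter> S \<times> S = {(u, v). (u, v) \<in> S \<times> S \<and> u \<noteq> v}"
    using True \<open>finite S\<close> by (simp add: clique_def complete_digraph_pair_def)
  \<comment> \<open>The set \<open>cliques_in\<close> does not constrain the diagonal; there the
    absence of loops decides.\<close>
  also have "\<dots> \<longleftrightarrow> S \<in> cliques_in (parcs H) (pverts H)"
    using True assms(2) by (auto simp: cliques_in_def)
  finally show ?thesis .
qed (auto simp: clique_def cliques_in_def)

lemma num_cliques_eq_clique_count:
  assumes "finite (pverts H)" "\<And>x. (x, x) \<notin> parcs H"
  shows "num_cliques H = clique_count H"
  using clique_iff_cliques_in[OF assms] by (simp add: num_cliques_def clique_count_def)

text \<open>Arcs are pairs of vertices on both sides, so the vertex map determines the arc map. That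
  arcs of \<open>H\<close> join vertices of \<open>H\<close> makes the induced arc map onto.\<close>

lemma graph_iso_iff_induced_iso:
  assumes G: "pair_graph G" and H: "parcs H \<subseteq> pverts H \<times> pverts H"
  shows "graph_iso G H \<longleftrightarrow> induced_iso (parcs G) (pverts G) H"
proof
  interpret pair_graph G by (fact G)
  assume "graph_iso G H"
  then obtain h where h: "pre_digraph.digraph_isomorphism (with_proj G) h"
    "with_proj H = app_iso h (with_proj G)"
    by (auto simp: graph_iso_def digraph_iso_def)
  define f where "f = iso_verts h"
  \<comment> \<open>Comparing fields forces the tail and head maps of \<open>h\<close> to be the
    projections, which pins down \<open>iso_arcs h\<close> on every arc.\<close>
  have V: "pverts H = f ` pverts G" "parcs H = iso_arcs h ` parcs G"
    "iso_tail h = fst" "iso_head h = snd"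
    using arg_cong[OF h(2), of verts] arg_cong[OF h(2), of arcs]
      arg_cong[OF h(2), of tail] arg_cong[OF h(2), of head] by (simp_all add: f_def)
  have inj: "inj_on f (pverts G)"
    using h(1) by (simp add: pre_digraph.digraph_isomorphism_def f_def)
  have arc: "iso_arcs h (u, v) = (f u, f v)" if "(u, v) \<in> parcs G" for u v
    using h(1) that V(3,4)
    by (auto simp: pre_digraph.digraph_isomorphism_def f_def prod_eq_iff)
  have "(u, v) \<in> parcs G \<longleftrightarrow> (f u, f v) \<in> parcs H" if uv: "u \<in> pverts G" "v \<in> pverts G" for u v
  proof
    assume "(u, v) \<in> parcs G"
    then show "(f u, f v) \<in> parcs H" unfolding V(2) using arc by (metis image_eqI)
  next
    assume "(f u, f v) \<in> parcs H"
    then obtain u' v' where e: "(u', v') \<in> parcs G" "(f u, f v) = iso_arcs h (u', v')"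
      unfolding V(2) by auto
    then have "f u = f u'" "f v = f v'" using arc by auto
    then have "u = u'" "v = v'" using inj uv in_arcsD1[OF e(1)] in_arcsD2[OF e(1)]
      by (auto dest: inj_onD)
    then show "(u, v) \<in> parcs G" using e by simp
  qed
  then show "induced_iso (parcs G) (pverts G) H"
    unfolding induced_iso_def bij_betw_def using inj V(1) by blast
next
  interpret pair_graph G by (fact G)
  assume "induced_iso (parcs G) (pverts G) H"
  then obtain f where f: "bij_betw f (pverts G) (pverts H)"
    "\<And>u v. u \<in> pverts G \<Longrightarrow> v \<in> pverts G \<Longrightarrow> (u, v) \<in> parcs G \<longleftrightarrow> (f u, f v) \<in> parcs H"
    by (auto simp: induced_iso_def)
  define h where "h = \<lparr>iso_verts = f, iso_arcs = map_prod f f, iso_head = snd, iso_tail = fst\<rparr>"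
  have inj: "inj_on f (pverts G)" and im: "f ` pverts G = pverts H"
    using f(1) by (auto simp: bij_betw_def)
  have sub: "parcs G \<subseteq> pverts G \<times> pverts G" using in_arcsD1 in_arcsD2 by auto
  have arcs: "map_prod f f ` parcs G = parcs H"
  proof
    show "map_prod f f ` parcs G \<subseteq> parcs H" using f(2) sub by auto
    show "parcs H \<subseteq> map_prod f f ` parcs G"
    proof
      fix e assume e: "e \<in> parcs H"
      then obtain u v where uv: "e = (f u, f v)" "u \<in> pverts G" "v \<in> pverts G"
        using H im by (cases e) blast
      then show "e \<in> map_prod f f ` parcs G"
        using f(2) e by (auto simp: map_prod_def intro!: image_eqI[of _ _ "(u, v)"])
    qed
  qed
  have "inj_on (map_prod f f) (parcs G)"
    using map_prod_inj_on[OF inj inj] sub by (rule inj_on_subset)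
  then have "pre_digraph.digraph_isomorphism (with_proj G) h"
    using inj wf_digraph by (simp add: pre_digraph.digraph_isomorphism_def h_def)
  moreover have "with_proj H = app_iso h (with_proj G)"
    using im arcs by (simp add: with_proj_def app_iso_def h_def)
  ultimately show "graph_iso G H" unfolding graph_iso_def digraph_iso_def by blast
qed

lemma card_closed_nbhd_eq_out_degree:
  assumes "pair_graph G" "v \<in> pverts G"
  shows "card (closed_nbhd (parcs G) (pverts G) v) = out_degree (with_proj G) v + 1"
proof -
  interpret pair_graph G by fact
  have "closed_nbhd (parcs G) (pverts G) v = insert v (snd ` out_arcs (with_proj G) v)"
    using assms(2) in_arcsD2 by (force simp: closed_nbhd_def)
  moreover have "v \<notin> snd ` out_arcs (with_proj G) v" using no_loops by fastforce
  moreover have "card (snd ` out_arcs (with_proj G) v) = out_degree (with_proj G) v"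
    unfolding out_degree_def by (intro card_image) (auto simp: inj_on_def prod_eq_iff)
  moreover have "finite (out_arcs (with_proj G) v)" by (rule finite_out_arcs)
  ultimately show ?thesis by simp
qed

theorem mainTheorem1:
  fixes n r a b :: nat and G :: "'a pair_pre_digraph"
  assumes "n = a * (r + 1) + b" and "b \<le> r"
    and "pair_graph G" and "card (pverts G) = n"
    and "max_degree G \<le> r"
  shows "num_cliques G
           \<le> num_cliques (disjoint_union (disjoint_copies a (complete_graph (r + 1))) (complete_graph b)) \<and>
         (num_cliques G
           = num_cliques (disjoint_union (disjoint_copies a (complete_graph (r + 1))) (complete_graph b)) \<longleftrightarrow>
           graph_iso G (disjoint_union (disjoint_copies a (complete_graph (r + 1))) (complete_graph b)) \<or>
           r = 2 \<and> 1 \<le> a \<and>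
             (graph_iso G (disjoint_union (disjoint_copies (a - 1) (complete_graph 3)) (cycle_graph 4)) \<or>
              graph_iso G (disjoint_union (disjoint_copies (a - 1) (complete_graph 3)) (cycle_graph 5))))"
proof -
  interpret pair_graph G by fact
  let ?E = "parcs G" and ?V = "pverts G"
  interpret simple_rel ?E
    using arcs_symmetric no_loops by unfold_locales fastforce+
  have fin: "finite ?V" by (rule pair_finite_verts)
  have deg: "card (closed_nbhd ?E ?V v) \<le> r + 1" if "v \<in> ?V" for v
  proof -
    have "out_degree (with_proj G) v \<le> max_degree G"
      unfolding max_degree_def using that fin by (intro Max_ge) auto
    then show ?thesis
      using card_closed_nbhd_eq_out_degree[OF \<open>pair_graph G\<close> that] assms(5) by linarith
  qed
  have kG: "num_cliques G = card (cliques_in ?E ?V)"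
    using num_cliques_eq_clique_count[OF fin irrefl_E] by (simp add: clique_count_def)
  have wf: "parcs (union_complete a (r + 1) b) \<subseteq> pverts (union_complete a (r + 1) b)
      \<times> pverts (union_complete a (r + 1) b)"
    "parcs (union_cycle (a - 1) m) \<subseteq> pverts (union_cycle (a - 1) m) \<times> pverts (union_cycle (a - 1) m)"
    for m
    by (auto simp: disjoint_union_def disjoint_copies_def complete_graph_def cycle_graph_def)
  note iso = graph_iso_iff_induced_iso[OF \<open>pair_graph G\<close> wf(1)]
    graph_iso_iff_induced_iso[OF \<open>pair_graph G\<close> wf(2)]
  have kH: "num_cliques (union_complete a (r + 1) b) = extremal_count r n"
    unfolding assms(1) extremal_count_eq[OF assms(2)] clique_count_union_complete[symmetric]
    by (rule num_cliques_eq_clique_count)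
       (auto simp: disjoint_union_def disjoint_copies_def complete_graph_def)
  have inv: "card (cliques_in ?E ?V) = clique_count H" if "induced_iso ?E ?V H"
    for H :: "'b pair_pre_digraph"
    using that card_cliques_in_iso unfolding induced_iso_def clique_count_def by blast
  have "card (cliques_in ?E ?V) = extremal_count r n"
    if "induced_iso ?E ?V (union_complete a (r + 1) b)"
    unfolding assms(1) extremal_count_eq[OF assms(2)] clique_count_union_complete[symmetric]
    using that by (rule inv)
  moreover have "card (cliques_in ?E ?V) = extremal_count r n"
    if "r = 2" "1 \<le> a" and m: "m = 4 \<or> m = 5" and i: "induced_iso ?E ?V (union_cycle (a - 1) m)" for m
  proof -
    have "n = (a - 1) * 3 + m"
      using card_eq_if_induced_iso[OF i] assms(4)
        card_pverts_union_copies[of "cycle_graph m" "a - 1" 3] by simp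
    \<comment> \<open>Comparing the two vertex counts modulo 3. A 4-cycle thus replaces a triangle
      with one extra vertex, a 5-cycle a triangle with an extra edge, and the clique counts
      agree.\<close>
    then have "b = m - 3" using assms(1,2) m that(1,2) by auto
    then show ?thesis
      unfolding assms(1) extremal_count_eq[OF assms(2)] inv[OF i] clique_count_union_cycle[OF m]
      using m that(1,2) by auto
  qed
  moreover have "card (cliques_in ?E ?V) \<le> extremal_count r n"
    using card_cliques_in_le[OF fin deg] assms(4) by simp
  moreover have "card (cliques_in ?E ?V) = extremal_count r n \<Longrightarrow>
      induced_iso ?E ?V (union_complete a (r + 1) b) \<or>
      r = 2 \<and> 1 \<le> a \<and> (induced_iso ?E ?V (union_cycle (a - 1) 4) \<or> induced_iso ?E ?V (union_cycle (a - 1) 5))"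
    using extremal_structure[OF fin deg, where a = a and b = b] assms by simp
  ultimately show ?thesis
    unfolding kG kH iso by blast
qed

end
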